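(* Let $D,R\ge2$ be arbitrary real numbers. Then for all except at most $O\big(D^2R(\log R)^2/\log D\big)$ primes $p$ the following holds: for any fixed integer $k\ge1$ and any $m\mid p-1$ such that $d=(p-1)/m$ is odd with $d\le D$, \[ M_{2k}(p,m)=a(k)+O\Big(\frac{(\log p)^{10k^2+10}}{R^{1/2}}+\frac{D(\log p)^{20k}}{p}+p^{-1/2}\Big), \] where the implied constant in the error term may depend on $k$ and the one in the count of exceptional primes is absolute.
   Context: $\mathcal{G}_m$ is the unique subgroup of $\mathbb{F}_p^*$ of index $m$; $\mathcal{X}_{p,m}$ is the group of multiplicative characters of $\mathbb{F}_p^*$ trivial on $\mathcal{G}_m$, $\mathcal{X}_{p,m}^-=\{\chi\in\mathcal{X}_{p,m}:\chi(-1)=-1\}$, $L(1,\chi)=\sum_{n\ge1}\chi(n)/n$, and $M_\nu(p,m)=\frac{2}{m}\sum_{\chi\in\mathcal{X}_{p,m}^-}|L(1,\chi)|^\nu$. $\tau_k(n)$ is the number of ordered $k$-tuples of positive integers with product $n$, and $a(k)=\sum_{n\ge1}\tau_k(n)^2/n^2$. *)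

theory Defs
  imports Complex_Main "HOL-Number_Theory.Residues"
begin

text \<open>The group of units of the prime field, on the representatives \<open>1, \<dots>, p - 1\<close>.\<close>

definition Fp_star :: "nat \<Rightarrow> int monoid" where
  "Fp_star p = units_of (residue_ring (int p))"

definition complex_star :: "complex monoid" where
  "complex_star = \<lparr>carrier = UNIV - {0}, monoid.mult = (*), one = 1\<rparr>"

definition index_subgroup :: "nat \<Rightarrow> nat \<Rightarrow> int set" where
  "index_subgroup p m =
     (THE H. subgroup H (Fp_star p) \<and> card (rcosets\<^bsub>Fp_star p\<^esub> H) = m)"

text \<open>
  \<^const>\<open>hom\<close> constrains a function only on the carrier. Setting it to 0 elsewhere makes the
  representation of a character unique, so that sums over sets of characters are finite sums.
  As \<open>0\<close> is outside the carrier, \<open>\<lambda>n. \<chi> (n mod p)\<close> is then the usual extension of \<open>\<chi>\<close> to the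
  integers, vanishing at the multiples of \<open>p\<close>.
\<close>

definition mult_characters :: "nat \<Rightarrow> (int \<Rightarrow> complex) set" where
  "mult_characters p =
     {\<chi> \<in> hom (Fp_star p) complex_star. \<forall>a. a \<notin> carrier (Fp_star p) \<longrightarrow> \<chi> a = 0}"

definition char_ext :: "nat \<Rightarrow> (int \<Rightarrow> complex) \<Rightarrow> int \<Rightarrow> complex" where
  "char_ext p \<chi> n = \<chi> (n mod int p)"

definition characters_trivial_on_index :: "nat \<Rightarrow> nat \<Rightarrow> (int \<Rightarrow> complex) set" where
  "characters_trivial_on_index p m =
     {\<chi> \<in> mult_characters p. \<forall>a \<in> index_subgroup p m. \<chi> a = 1}"

definition odd_characters :: "nat \<Rightarrow> nat \<Rightarrow> (int \<Rightarrow> complex) set" where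
  "odd_characters p m =
     {\<chi> \<in> characters_trivial_on_index p m. char_ext p \<chi> (- 1) = - 1}"

text \<open>
  For a nontrivial character the series converges only conditionally; \<^const>\<open>suminf\<close> is the limit
  of the partial sums in the natural order.
\<close>

definition L_one :: "nat \<Rightarrow> (int \<Rightarrow> complex) \<Rightarrow> complex" where
  "L_one p \<chi> = (\<Sum>n. char_ext p \<chi> (int (Suc n)) / of_nat (Suc n))"

definition L_moment :: "nat \<Rightarrow> nat \<Rightarrow> nat \<Rightarrow> real" where
  "L_moment \<nu> p m = 2 / real m * (\<Sum>\<chi> \<in> odd_characters p m. norm (L_one p \<chi>) ^ \<nu>)"

definition divisor_tau :: "nat \<Rightarrow> nat \<Rightarrow> nat" where
  "divisor_tau k n =
     card {xs :: nat list. length xs = k \<and> (\<forall>x \<in> set xs. x > 0) \<and> prod_list xs = n}"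

definition a_const :: "nat \<Rightarrow> real" where
  "a_const k = (\<Sum>n. real (divisor_tau k (Suc n)) ^ 2 / real (Suc n) ^ 2)"

end

theory Submission
  imports Defs "HOL-Number_Theory.Residue_Primitive_Roots" "HOL-Analysis.Analysis"
begin

text \<open>
  Truncate \<open>L(1,\<chi>)\<close> at \<open>p\<^sup>2\<close> and expand the \<open>2k\<close>-th power. By orthogonality of the odd characters
  only pairs \<open>(a, b)\<close> with \<open>a^(2d) = b^(2d)\<close> modulo \<open>p\<close> survive: the diagonal \<open>a = b\<close> gives \<open>a(k)\<close>, and
  the rest is an error term.

  For fixed \<open>a \<noteq> b\<close> the number \<open>a^(2d) - b^(2d)\<close> has at most \<open>2 d ln (a b) / ln (d + 1)\<close> prime
  divisors \<open>p\<close> with \<open>d\<close> dividing \<open>p - 1\<close>, since all of these exceed \<open>d\<close>. Weighting the pairs with a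
  convergent weight close to \<open>1 / (a b)\<close> and summing over \<open>d \<le> D\<close>, the total weight of all coincidences
  over all primes is \<open>O(D^2 / ln D)\<close>. Hence the weight exceeds \<open>1 / R\<close> only for \<open>O(D^2 R / ln D)\<close>
  primes, and these are the exceptional ones.
\<close>

section \<open>Odd characters\<close>

text \<open>The expanded power runs over pairs up to \<open>p^(2 k)\<close>, so a set of bad primes
  read off from it would depend on \<open>k\<close>. Two devices prevent this. A weight with a
  convergent double series makes the length of the sums irrelevant. Cauchy-Schwarz then confines the
  divisor functions to a sum over all pairs, leaving only the bare weight on the coincidences.

  The cut at \<open>p^2\<close> balances two needs: partial sums of a character are at most
  \<open>p\<close>, so the tail is \<open>O(1/p)\<close>, while the logarithm of the length is still
  \<open>O(ln p)\<close>.

  The exponent \<open>2 d\<close> comes from the odd characters. Evaluated at a primitive root they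
  are the solutions of \<open>z^(m/2) = -1\<close>, so their mean value sees discrete logarithms
  only modulo \<open>m/2\<close>, that is, residues up to sign and up to elements of the subgroup of
  index \<open>m\<close>. Oddness of \<open>d\<close> keeps -1 out of that subgroup, so that exactly
  half of the \<open>m\<close> characters are odd.\<close>

lemma Fp_star_simps:
  assumes "prime p"
  shows "carrier (Fp_star p) = {1..int p - 1}"
    and "x \<otimes>\<^bsub>Fp_star p\<^esub> y = x * y mod int p"
    and "\<one>\<^bsub>Fp_star p\<^esub> = 1"
    and "group (Fp_star p)"
proof -
  interpret R: residues_prime p "residue_ring (int p)"
    by unfold_locales (use assms in auto)
  show "carrier (Fp_star p) = {1..int p - 1}"
    using R.res_prime_units_eq prime_gt_0_nat[OF assms]
    by (simp add: Fp_star_def units_of_def of_nat_diff)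
  show "x \<otimes>\<^bsub>Fp_star p\<^esub> y = x * y mod int p"
    using R.res_mult_eq by (simp add: Fp_star_def units_of_def)
  show "\<one>\<^bsub>Fp_star p\<^esub> = 1"
    using R.res_one_eq by (simp add: Fp_star_def units_of_def)
  show "group (Fp_star p)"
    unfolding Fp_star_def by (rule R.units_group)
qed

lemma Fp_star_pow:
  assumes "prime p"
  shows "x [^]\<^bsub>Fp_star p\<^esub> (n :: nat) = x ^ n mod int p"
proof (induction n)
  case 0
  have "1 mod int p = 1"
    using prime_gt_1_nat[OF assms] by simp
  then show ?case
    using Fp_star_simps(3)[OF assms] by (simp add: nat_pow_def)
next
  case (Suc n)
  have "x [^]\<^bsub>Fp_star p\<^esub> Suc n = (x [^]\<^bsub>Fp_star p\<^esub> n) \<otimes>\<^bsub>Fp_star p\<^esub> x"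
    by (simp add: nat_pow_def)
  also have "\<dots> = x ^ Suc n mod int p"
    unfolding Fp_star_simps(2)[OF assms] Suc by (simp add: mod_simps mult.commute)
  finally show ?case .
qed

section \<open>Characters as completely multiplicative functions on the integers\<close>

lemma not_dvd_mod_carrier:
  assumes "prime p"
  shows "a mod int p \<in> carrier (Fp_star p) \<longleftrightarrow> \<not> int p dvd a"
proof -
  have "0 < int p" using prime_gt_0_nat[OF assms] by simp
  then have "0 \<le> a mod int p" "a mod int p < int p" by auto
  then show ?thesis
    unfolding Fp_star_simps[OF assms] dvd_eq_mod_eq_0 by auto
qed

lemma char_ext_cong: "[a = b] (mod int p) \<Longrightarrow> char_ext p f a = char_ext p f b"
  by (simp add: char_ext_def Cong.cong_def)

context
  fixes p :: nat and f :: "int \<Rightarrow> complex"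
  assumes p: "prime p" and f: "f \<in> mult_characters p"
begin

lemma char_ext_eq_0_iff: "char_ext p f a = 0 \<longleftrightarrow> int p dvd a"
proof (cases "int p dvd a")
  case True
  then show ?thesis
    using f not_dvd_mod_carrier[OF p, of a] by (auto simp: mult_characters_def char_ext_def)
next
  case False
  then have "f (a mod int p) \<in> carrier complex_star"
    using f not_dvd_mod_carrier[OF p, of a] by (auto simp: mult_characters_def hom_def)
  then show ?thesis
    using False by (auto simp: complex_star_def char_ext_def)
qed

lemma char_ext_mult: "char_ext p f (a * b) = char_ext p f a * char_ext p f b"
proof (cases "int p dvd a \<or> int p dvd b")
  case True
  then have "int p dvd a * b" by auto
  then have "char_ext p f (a * b) = 0" by (simp add: char_ext_eq_0_iff)
  moreover have "char_ext p f a = 0 \<or> char_ext p f b = 0"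
    using True by (simp add: char_ext_eq_0_iff)
  ultimately show ?thesis by auto
next
  case False
  then have "a mod int p \<in> carrier (Fp_star p)" "b mod int p \<in> carrier (Fp_star p)"
    using not_dvd_mod_carrier[OF p] by auto
  then have "f ((a mod int p) \<otimes>\<^bsub>Fp_star p\<^esub> (b mod int p)) =
      f (a mod int p) \<otimes>\<^bsub>complex_star\<^esub> f (b mod int p)"
    using f by (auto simp: mult_characters_def hom_def)
  then show ?thesis
    by (simp add: Fp_star_simps(2)[OF p] complex_star_def char_ext_def mod_mult_eq)
qed

lemma char_ext_1: "char_ext p f 1 = 1"
proof -
  have "\<not> int p dvd 1" using prime_gt_1_nat[OF p] by auto
  then have "char_ext p f 1 \<noteq> 0" by (simp add: char_ext_eq_0_iff)
  then show ?thesis using char_ext_mult[of 1 1] by simp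
qed

lemma char_ext_power: "char_ext p f (a ^ n) = char_ext p f a ^ n"
  by (induction n) (simp_all add: char_ext_1 char_ext_mult)

text \<open>By Euler's theorem a value at an integer prime to \<open>p\<close> is a
  \<open>(p - 1)\<close>-th root of unity.\<close>

lemma norm_char_ext: "norm (char_ext p f a) = (if int p dvd a then 0 else 1)"
proof (cases "int p dvd a")
  case True
  then show ?thesis using char_ext_eq_0_iff by simp
next
  case False
  then have "coprime a (int p)"
    using p by (metis coprime_commute prime_imp_coprime prime_nat_int_transfer)
  then have "[a ^ (p - 1) = 1] (mod int p)"
    using residues.euler_theorem[of "int p" a] prime_gt_1_nat[OF p] totient_prime[OF p]
    by (simp add: residues_def)
  then have "char_ext p f a ^ (p - 1) = 1"
    using char_ext_cong char_ext_power char_ext_1 by metis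
  then have "norm (char_ext p f a) ^ (p - 1) = 1"
    by (metis norm_one norm_power)
  then have "norm (char_ext p f a) = 1"
    using prime_gt_1_nat[OF p] power_eq_1_iff[of "norm (char_ext p f a)" "p - 1"] by simp
  then show ?thesis using False by simp
qed

lemma norm_char_ext_le: "norm (char_ext p f a) \<le> 1"
  by (simp add: norm_char_ext)

end

section \<open>Discrete logarithms, the subgroup of index \<open>m\<close>, and the odd
  characters\<close>

lemma primitive_root_exists:
  assumes "prime p"
  obtains g :: nat where "\<not> p dvd g" "ord p g = p - 1"
    "\<And>a. \<not> int p dvd a \<Longrightarrow> \<exists>i. [a = int g ^ i] (mod int p)"
proof -
  obtain g where g: "residue_primroot p g"
    using prime_primitive_root_exists[OF _ assms] prime_gt_1_nat[OF assms] by blast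
  have "coprime p g" "ord p g = p - 1"
    using g assms by (simp_all add: residue_primroot_def totient_prime)
  moreover from this have "\<not> p dvd g"
    using prime_gt_1_nat[OF assms] coprime_absorb_left[of p g] by force
  ultimately have 1: "\<not> p dvd g" "ord p g = p - 1" by simp_all
  have "\<exists>i. [a = int g ^ i] (mod int p)" if a: "\<not> int p dvd a" for a
  proof -
    have "0 < int p" using prime_gt_0_nat[OF assms] by simp
    then have r: "0 \<le> a mod int p" "a mod int p < int p" "a mod int p \<noteq> 0"
      using a by (auto simp: dvd_eq_mod_eq_0)
    then have "nat (a mod int p) \<in> totatives p"
      using assms by (auto simp: totatives_prime nat_less_iff)
    moreover have "(\<lambda>i. g ^ i mod p) ` {..<totient p} = totatives p"
      using residue_primroot_is_generator[OF _ g] prime_gt_1_nat[OF assms]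
      by (auto simp: bij_betw_def)
    ultimately obtain i where "nat (a mod int p) = g ^ i mod p" by auto
    then have "a mod int p = int g ^ i mod int p"
      using r by (metis int_nat_eq of_nat_mod of_nat_power)
    then show ?thesis unfolding Cong.cong_def by blast
  qed
  from that[OF 1 this] show ?thesis .
qed

text \<open>Used below under the name \<open>gen\<close>: questions about \<open>d\<close>-th powers
  and characters become congruences between exponents.\<close>

lemma cong_power_generator_iff:
  assumes "prime p" "\<not> p dvd g" "ord p g = p - 1"
  shows "[int g ^ i = int g ^ j] (mod int p) \<longleftrightarrow> [i = j] (mod (p - 1))"
proof -
  have "coprime p g" using assms by (simp add: prime_imp_coprime)
  then have "[g ^ i = g ^ j] (mod p) \<longleftrightarrow> [i = j] (mod (p - 1))"
    using order_divides_expdiff[of p g i j] assms by simp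
  then show ?thesis
    using cong_int_iff[of "g ^ i" "g ^ j" p] by simp
qed

text \<open>The definite description needs existence and uniqueness. The \<open>d\<close>-torsion
  has exactly \<open>d\<close> elements, so by Lagrange its index is \<open>m\<close>. Conversely a
  subgroup of index \<open>m\<close> has order \<open>d\<close>, hence lies in the
  \<open>d\<close>-torsion and fills it.\<close>

lemma index_subgroup_eq:
  assumes p: "prime p" and m: "m dvd p - 1" and d: "d = (p - 1) div m"
  shows "index_subgroup p m = {a \<in> {1..int p - 1}. [a ^ d = 1] (mod int p)}"
    (is "_ = ?H")
proof -
  interpret G: group "Fp_star p" by (rule Fp_star_simps(4)[OF p])
  have p1: "p > 1" using p by (rule prime_gt_1_nat)
  have one: "1 mod int p = 1" using p1 by simp
  have md: "p - 1 = m * d" using m d by simp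
  then have pos: "m > 0" "d > 0" using p1 by (auto intro: Nat.gr0I)
  obtain g where g: "\<not> p dvd g" "ord p g = p - 1"
    "\<And>a. \<not> int p dvd a \<Longrightarrow> \<exists>i. [a = int g ^ i] (mod int p)"
    using primitive_root_exists[OF p] by metis
  note gen = cong_power_generator_iff[OF p g(1,2)]
  have carrier: "carrier (Fp_star p) = {1..int p - 1}"
    by (rule Fp_star_simps(1)[OF p])
  have order: "Coset.order (Fp_star p) = p - 1"
    using p1 by (simp add: Coset.order_def carrier)
  have H: "?H = {a \<in> carrier (Fp_star p). a [^]\<^bsub>Fp_star p\<^esub> d = \<one>\<^bsub>Fp_star p\<^esub>}"
    unfolding carrier Fp_star_pow[OF p] Fp_star_simps(3)[OF p] Cong.cong_def one by simp
  have comm: "x \<otimes>\<^bsub>Fp_star p\<^esub> y = y \<otimes>\<^bsub>Fp_star p\<^esub> x" for x y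
    by (simp add: Fp_star_simps(2)[OF p] mult.commute)
  have sub: "subgroup ?H (Fp_star p)"
    unfolding H
  proof (rule G.subgroupI)
    show "{a \<in> carrier (Fp_star p). a [^]\<^bsub>Fp_star p\<^esub> d = \<one>\<^bsub>Fp_star p\<^esub>} \<noteq> {}"
      using G.nat_pow_one G.one_closed by blast
  qed (auto simp: G.nat_pow_inv G.inv_one intro!: G.pow_mult_distrib[THEN trans] comm)
  \<comment> \<open>For \<open>a = g^i\<close> the condition \<open>a^d = 1\<close> says that
    \<open>m * d\<close> divides \<open>i * d\<close>, so \<open>i\<close> is a multiple of
    \<open>m\<close>; the cofactor matters only modulo \<open>d\<close>.\<close>
  have image: "?H = (\<lambda>i. int g ^ (m * i) mod int p) ` {..<d}"
  proof (intro equalityI subsetI)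
    fix a assume a: "a \<in> ?H"
    then have "\<not> int p dvd a" by (auto dest: zdvd_imp_le)
    then obtain i where i: "[a = int g ^ i] (mod int p)" using g(3) by blast
    then have "[int g ^ (i * d) = int g ^ 0] (mod int p)"
      using cong_trans[OF cong_sym[OF cong_pow[OF i, of d]]] a by (simp add: power_mult)
    then have "m * d dvd i * d" unfolding gen md cong_0_iff .
    then obtain j where j: "i = m * j" using pos by auto
    have "[m * (j mod d) = m * j] (mod (p - 1))"
      unfolding md Cong.cong_def by simp
    then have "[int g ^ (m * (j mod d)) = a] (mod int p)"
      using i j gen cong_sym cong_trans by metis
    moreover have "a mod int p = a" using a by simp
    ultimately have "a = int g ^ (m * (j mod d)) mod int p"
      unfolding Cong.cong_def by simp
    then show "a \<in> (\<lambda>i. int g ^ (m * i) mod int p) ` {..<d}"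
      using pos by auto
  next
    fix a assume "a \<in> (\<lambda>i. int g ^ (m * i) mod int p) ` {..<d}"
    then obtain i where a: "a = int g ^ (m * i) mod int p" by blast
    have "\<not> int p dvd int g ^ (m * i)"
      using g(1) p prime_dvd_power_int_iff prime_dvd_power int_dvd_int_iff
      by (metis of_nat_power)
    then have "a \<in> {1..int p - 1}"
      using not_dvd_mod_carrier[OF p] carrier a by blast
    moreover have "[int g ^ (m * i * d) = int g ^ 0] (mod int p)"
      unfolding gen md cong_0_iff by (simp add: ac_simps)
    then have "[a ^ d = 1] (mod int p)"
      unfolding a Cong.cong_def by (simp add: power_mult power_mod)
    ultimately show "a \<in> ?H" by simp
  qed
  have "inj_on (\<lambda>i. int g ^ (m * i) mod int p) {..<d}"
  proof (rule inj_onI)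
    fix i j assume ij: "i \<in> {..<d}" "j \<in> {..<d}"
      and "int g ^ (m * i) mod int p = int g ^ (m * j) mod int p"
    then have "[m * i = m * j] (mod (m * d))"
      using gen md by (simp add: Cong.cong_def)
    then show "i = j"
      using ij pos by (simp add: Cong.cong_def mult_mod_right[symmetric])
  qed
  then have cardH: "card ?H = d"
    unfolding image by (simp add: card_image)
  have lagr: "card (rcosets\<^bsub>Fp_star p\<^esub> K) = m \<longleftrightarrow> card K = d"
    if K: "subgroup K (Fp_star p)" for K
  proof -
    have e: "card (rcosets\<^bsub>Fp_star p\<^esub> K) * card K = m * d"
      using G.lagrange[OF K] order md by simp
    show ?thesis
    proof
      assume "card (rcosets\<^bsub>Fp_star p\<^esub> K) = m"
      then show "card K = d" using e pos by simp
    next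
      assume "card K = d"
      then show "card (rcosets\<^bsub>Fp_star p\<^esub> K) = m" using e pos by simp
    qed
  qed
  have uniq: "K = ?H" if K: "subgroup K (Fp_star p)" and c: "card K = d" for K
  proof (rule card_subset_eq)
    show "finite ?H" unfolding image by simp
    show "card K = card ?H" using c cardH by simp
    show "K \<subseteq> ?H"
    proof
      fix a assume a: "a \<in> K"
      interpret K: group "(Fp_star p)\<lparr>carrier := K\<rparr>"
        using K G.group_axioms by (rule subgroup.subgroup_is_group)
      have "a [^]\<^bsub>(Fp_star p)\<lparr>carrier := K\<rparr>\<^esub> Coset.order ((Fp_star p)\<lparr>carrier := K\<rparr>) = \<one>\<^bsub>(Fp_star p)\<lparr>carrier := K\<rparr>\<^esub>"
        using a by (intro K.pow_order_eq_1) simp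
      then have "a [^]\<^bsub>Fp_star p\<^esub> d = \<one>\<^bsub>Fp_star p\<^esub>"
        using c by (simp add: Coset.order_def G.nat_pow_consistent[symmetric])
      moreover have "a \<in> carrier (Fp_star p)" using a K subgroup.subset by blast
      ultimately show "a \<in> ?H" unfolding H by simp
    qed
  qed
  show ?thesis
    unfolding index_subgroup_def
  proof (rule the_equality)
    show "subgroup ?H (Fp_star p) \<and> card (rcosets\<^bsub>Fp_star p\<^esub> ?H) = m"
      using sub lagr[OF sub] cardH by blast
  next
    fix K assume "subgroup K (Fp_star p) \<and> card (rcosets\<^bsub>Fp_star p\<^esub> K) = m"
    then show "K = ?H" using uniq lagr by blast
  qed
qed

text \<open>A character is determined by its value \<open>z\<close> at the primitive root.
  Triviality on the subgroup of index \<open>m\<close> amounts to \<open>z^m = 1\<close>, so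
  \<open>z^n\<close> is 1 or -1 for \<open>n = m div 2\<close>. Since \<open>-1 = g^(n d)\<close>,
  oddness says \<open>(z^n)^d = -1\<close>, which for odd \<open>d\<close> selects
  \<open>z^n = -1\<close>.\<close>

lemma odd_characters_bij:
  assumes p: "prime p" and p2: "p > 2" and m: "m dvd p - 1" and d: "d = (p - 1) div m"
    and odd: "odd d" and g: "\<not> p dvd g" "ord p g = p - 1"
    "\<And>a. \<not> int p dvd a \<Longrightarrow> \<exists>i. [a = int g ^ i] (mod int p)"
  shows "bij_betw (\<lambda>f. char_ext p f (int g)) (odd_characters p m) {z. z ^ (m div 2) = - 1}"
proof (rule bij_betwI')
  note gen = cong_power_generator_iff[OF p g(1,2)]
  define n where "n = m div 2"
  have md: "p - 1 = m * d" using m d by simp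
  have evp: "even (p - 1)" using p p2 by (simp add: prime_odd_nat)
  then have m2: "m = 2 * n" using md odd unfolding n_def by (metis dvd_mult_div_cancel even_mult_iff)
  have pn: "p - 1 = 2 * (n * d)" using md m2 by simp
  have pos: "n > 0" "d > 0" using pn p2 by (auto intro: Nat.gr0I)
  \<comment> \<open>The exponent is half the order of \<open>g\<close>, so the power is a square
    root of 1 different from 1.\<close>
  have minus1: "[-1 = int g ^ (n * d)] (mod int p)"
  proof -
    have "[int g ^ (2 * (n * d)) = int g ^ 0] (mod int p)"
      unfolding gen pn by (simp add: Cong.cong_def)
    then have "int p dvd int g ^ (2 * (n * d)) - 1"
      by (simp add: cong_iff_dvd_diff)
    also have "int g ^ (2 * (n * d)) - 1 = (int g ^ (n * d) - 1) * (int g ^ (n * d) + 1)"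
      by (simp add: power_mult[of _ "n * d" 2] mult.commute[of 2] power2_eq_square square_diff_one_factored)
    finally have "int p dvd (int g ^ (n * d) - 1) * (int g ^ (n * d) + 1)" .
    moreover have "\<not> int p dvd int g ^ (n * d) - 1"
    proof
      assume "int p dvd int g ^ (n * d) - 1"
      then have "[int g ^ (n * d) = int g ^ 0] (mod int p)" by (simp add: cong_iff_dvd_diff)
      then have "2 * (n * d) dvd n * d" unfolding gen pn cong_0_iff .
      then show False using pos by (auto dest: dvd_imp_le)
    qed
    ultimately have "int p dvd int g ^ (n * d) + 1"
      using p prime_dvd_mult_iff[of "int p"] by auto
    then have "int p dvd (- 1) - int g ^ (n * d)"
      by (subst dvd_minus_iff[symmetric]) (simp add: add.commute)
    then show ?thesis by (simp add: cong_iff_dvd_diff)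
  qed
  have H: "index_subgroup p m = {a \<in> {1..int p - 1}. [a ^ d = 1] (mod int p)}"
    by (rule index_subgroup_eq[OF p m d])
  have g_mod: "int g ^ i mod int p \<in> {1..int p - 1}" for i
  proof -
    have "\<not> int p dvd int g ^ i"
      using g(1) p prime_dvd_power by (metis int_dvd_int_iff of_nat_power)
    then show ?thesis using not_dvd_mod_carrier[OF p] Fp_star_simps(1)[OF p] by blast
  qed
  {
    fix f assume f: "f \<in> odd_characters p m"
    then have fm: "f \<in> mult_characters p"
      by (simp add: odd_characters_def characters_trivial_on_index_def)
    have "[int g ^ (m * d) = int g ^ 0] (mod int p)"
      unfolding gen md[symmetric] by (simp add: Cong.cong_def)
    then have "int g ^ m mod int p \<in> index_subgroup p m"
      using g_mod[of m] unfolding H by (simp add: Cong.cong_def power_mult power_mod)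
    then have "char_ext p f (int g ^ m) = 1"
      using f by (simp add: odd_characters_def characters_trivial_on_index_def char_ext_def)
    then have "char_ext p f (int g) ^ m = 1"
      by (simp add: char_ext_power[OF p fm])
    then have "(char_ext p f (int g) ^ n)\<^sup>2 = 1"
      by (simp add: m2 flip: power_mult) (simp add: mult.commute)
    then have "char_ext p f (int g) ^ n = 1 \<or> char_ext p f (int g) ^ n = -1"
      by (simp add: power2_eq_1_iff)
    moreover have "(char_ext p f (int g) ^ n) ^ d = - 1"
      using char_ext_cong[OF minus1, of f] f
      by (simp add: char_ext_power[OF p fm] odd_characters_def power_mult)
    ultimately show "char_ext p f (int g) \<in> {z. z ^ (m div 2) = - 1}"
      unfolding n_def by fastforce
  }
  {
    fix f1 f2 assume "f1 \<in> odd_characters p m" "f2 \<in> odd_characters p m"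
    then have f: "f1 \<in> mult_characters p" "f2 \<in> mult_characters p"
      by (auto simp: odd_characters_def characters_trivial_on_index_def)
    have "f1 = f2" if eq: "char_ext p f1 (int g) = char_ext p f2 (int g)"
    proof
      fix a
      show "f1 a = f2 a"
      proof (cases "a \<in> carrier (Fp_star p)")
        case False
        then show ?thesis using f by (simp add: mult_characters_def)
      next
        case True
        then have a: "a \<in> {1..int p - 1}" by (simp add: Fp_star_simps[OF p])
        then have "\<not> int p dvd a" by (auto dest: zdvd_imp_le)
        then obtain i where i: "[a = int g ^ i] (mod int p)" using g(3) by blast
        have "char_ext p f1 a = char_ext p f2 a"
          unfolding char_ext_cong[OF i, of f1] char_ext_cong[OF i, of f2] char_ext_power[OF p f(1)] char_ext_power[OF p f(2)] eq ..
        then show ?thesis using a by (simp add: char_ext_def)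
      qed
    qed
    then show "(char_ext p f1 (int g) = char_ext p f2 (int g)) = (f1 = f2)" by blast
  }
  {
    fix z :: complex assume "z \<in> {z. z ^ (m div 2) = - 1}"
    then have z: "z ^ n = -1" by (simp add: n_def)
    \<comment> \<open>Oddness of \<open>d\<close> is what makes the character built from
      \<open>z\<close> odd.\<close>
    then have zd: "z ^ (n * d) = -1" using odd by (simp add: power_mult)
    then have zp: "z ^ (p - 1) = 1" unfolding pn power_even_eq zd by simp
    have z_cong: "z ^ i = z ^ j" if "[i = j] (mod (p - 1))" for i j
    proof -
      have "z ^ i = z ^ (i mod (p - 1))" for i
      proof -
        have "z ^ i = z ^ ((p - 1) * (i div (p - 1)) + i mod (p - 1))" by simp
        then show ?thesis unfolding power_add power_mult zp by simp
      qed
      then show ?thesis using that unfolding Cong.cong_def by metis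
    qed
    define dl where "dl a = (SOME i. [a = int g ^ i] (mod int p))" for a
    have dl: "[a = int g ^ dl a] (mod int p)" if "\<not> int p dvd a" for a
      unfolding dl_def using g(3)[OF that] by (rule someI_ex)
    define f where "f a = (if a \<in> carrier (Fp_star p) then z ^ dl a else 0)" for a
    have ndvd: "\<not> int p dvd a" if "a \<in> carrier (Fp_star p)" for a
      using that by (auto simp: Fp_star_simps[OF p] dest: zdvd_imp_le)
    \<comment> \<open>\<open>dl\<close> picks an arbitrary discrete logarithm; as
      \<open>z^(p - 1) = 1\<close>, any other one gives the same value. This yields multiplicativity
      although \<open>dl\<close> itself need not be additive.\<close>
    have fi: "f a = z ^ i" if a: "a \<in> carrier (Fp_star p)" and i: "[a = int g ^ i] (mod int p)" for a i
    proof -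
      have "[int g ^ dl a = int g ^ i] (mod int p)"
        using dl[OF ndvd[OF a]] i cong_sym cong_trans by blast
      then show ?thesis using a unfolding gen f_def by (simp add: z_cong)
    qed
    have z0: "z \<noteq> 0" using z pos by (auto simp: power_0_left)
    have "f \<in> hom (Fp_star p) complex_star"
    proof (rule homI)
      fix a assume "a \<in> carrier (Fp_star p)"
      then show "f a \<in> carrier complex_star" using z0 by (simp add: f_def complex_star_def)
    next
      fix a b assume ab: "a \<in> carrier (Fp_star p)" "b \<in> carrier (Fp_star p)"
      then have "a \<otimes>\<^bsub>Fp_star p\<^esub> b \<in> carrier (Fp_star p)"
        using group.is_monoid[OF Fp_star_simps(4)[OF p]] by (rule monoid.m_closed[rotated])
      moreover have "[a \<otimes>\<^bsub>Fp_star p\<^esub> b = int g ^ (dl a + dl b)] (mod int p)"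
        using cong_mult[OF dl dl] ab ndvd
        by (simp add: Fp_star_simps(2)[OF p] power_add Cong.cong_def)
      ultimately have "f (a \<otimes>\<^bsub>Fp_star p\<^esub> b) = z ^ (dl a + dl b)" by (rule fi)
      then show "f (a \<otimes>\<^bsub>Fp_star p\<^esub> b) = f a \<otimes>\<^bsub>complex_star\<^esub> f b"
        using ab by (simp add: f_def power_add complex_star_def)
    qed
    then have fm: "f \<in> mult_characters p" by (simp add: mult_characters_def f_def)
    have fg: "char_ext p f (int g ^ i) = z ^ i" for i
      using fi[of "int g ^ i mod int p" i] g_mod[of i] Fp_star_simps(1)[OF p]
      by (simp add: char_ext_def Cong.cong_def)
    have "f a = 1" if a: "a \<in> index_subgroup p m" for a
    proof -
      have a': "a \<in> carrier (Fp_star p)" "[a ^ d = 1] (mod int p)"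
        using a unfolding H by (simp_all add: Fp_star_simps[OF p])
      then have i: "[a = int g ^ dl a] (mod int p)" using dl ndvd by blast
      then have "[int g ^ (dl a * d) = int g ^ 0] (mod int p)"
        using cong_trans[OF cong_sym[OF cong_pow[OF i, of d]] a'(2)] by (simp add: power_mult)
      then have "m * d dvd dl a * d" unfolding gen md cong_0_iff .
      then obtain j where "dl a = m * j" using pos by auto
      moreover have "z ^ m = 1" unfolding m2 power_even_eq z by simp
      ultimately show ?thesis using a'(1) by (simp add: f_def power_mult)
    qed
    moreover have "char_ext p f (- 1) = - 1"
      using char_ext_cong[OF minus1, of f] fg zd by simp
    ultimately have "f \<in> odd_characters p m"
      using fm by (simp add: odd_characters_def characters_trivial_on_index_def)
    moreover have "z = char_ext p f (int g)" using fg[of 1] by simp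
    ultimately show "\<exists>f\<in>odd_characters p m. z = char_ext p f (int g)" by blast
  }
qed

lemma cis_power_eq_iff:
  assumes "n > 0"
  shows "cis (2 * pi / real n) ^ i = cis (2 * pi / real n) ^ j \<longleftrightarrow> [i = j] (mod n)"
proof -
  have "cis (2 * pi / real n) ^ i = exp (2 * of_real pi * \<i> * of_nat i / of_nat n)" for i
    by (simp add: cis_conv_exp exp_of_nat_mult[symmetric] field_simps)
  then show ?thesis
    using complex_root_unity_eq[of n i j] assms by (simp add: Cong.cong_def)
qed

text \<open>\<open>m\<close> is even because \<open>m * d = p - 1\<close> is even and
  \<open>d\<close> is odd, and -1 has \<open>m div 2\<close> complex roots of order
  \<open>m div 2\<close>. Thus the factor \<open>2 / m\<close> in \<open>L_moment\<close> makes it a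
  genuine average.\<close>

lemma odd_characters_card:
  assumes "prime p" "p > 2" "m dvd p - 1" "d = (p - 1) div m" "odd d"
  shows "finite (odd_characters p m)" and "2 * card (odd_characters p m) = m" and "m > 0"
proof -
  obtain g where g: "\<not> p dvd g" "ord p g = p - 1"
    "\<And>a. \<not> int p dvd a \<Longrightarrow> \<exists>i. [a = int g ^ i] (mod int p)"
    using primitive_root_exists[OF assms(1)] by metis
  note bij = odd_characters_bij[OF assms g]
  have md: "p - 1 = m * d" using assms by simp
  have "even (p - 1)" using assms by (simp add: prime_odd_nat)
  then have even: "even m" using md assms(5) by (metis even_mult_iff)
  show m: "m > 0" using md assms(2) by (auto intro: Nat.gr0I)
  then have n: "m div 2 > 0" using even by auto
  show "finite (odd_characters p m)"
    using bij_betw_finite[OF bij] finite_nth_roots[OF n] by simp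
  show "2 * card (odd_characters p m) = m"
    using bij_betw_same_card[OF bij] card_nth_roots[OF _ n, of "-1"] even by simp
qed

text \<open>In terms of discrete logarithms \<open>i\<close>, \<open>j\<close> the sum is \<Sum>
  \<open>z^i * cnj z^j\<close> over the roots of \<open>z^n = -1\<close>. Rotation by a primitive
  \<open>n\<close>-th root of unity permutes these roots and multiplies the sum by a factor that is
  1 only for \<open>i\<close> congruent to \<open>j\<close> modulo \<open>n\<close>.\<close>

lemma odd_characters_orthogonal:
  assumes "prime p" "p > 2" "m dvd p - 1" "d = (p - 1) div m" "odd d"
    and a: "\<not> int p dvd a" and b: "\<not> int p dvd b" and ne: "\<not> int p dvd a ^ (2 * d) - b ^ (2 * d)"
  shows "(\<Sum>f\<in>odd_characters p m. char_ext p f a * cnj (char_ext p f b)) = 0"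
proof -
  obtain g where g: "\<not> p dvd g" "ord p g = p - 1"
    "\<And>a. \<not> int p dvd a \<Longrightarrow> \<exists>i. [a = int g ^ i] (mod int p)"
    using primitive_root_exists[OF assms(1)] by metis
  note bij = odd_characters_bij[OF assms(1-5) g]
  note gen = cong_power_generator_iff[OF assms(1) g(1,2)]
  define n where "n = m div 2"
  have md: "p - 1 = m * d" using assms by simp
  have "even (p - 1)" using assms by (simp add: prime_odd_nat)
  then have even: "even m" using md assms(5) by (metis even_mult_iff)
  have n: "n > 0" using odd_characters_card(3)[OF assms(1-5)] even unfolding n_def by auto
  have pn: "p - 1 = 2 * d * n" using md even unfolding n_def by auto
  obtain i j where i: "[a = int g ^ i] (mod int p)" and j: "[b = int g ^ j] (mod int p)"
    using g(3) a b by blast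
  \<comment> \<open>As \<open>p - 1 = 2 * d * n\<close>, a congruence modulo \<open>n\<close>
    multiplied by \<open>2 * d\<close> becomes one modulo \<open>p - 1\<close>, which would equate
    the \<open>2 d\<close>-th powers.\<close>
  have nij: "\<not> [i = j] (mod n)"
  proof
    assume "[i = j] (mod n)"
    then have "[2 * d * i = 2 * d * j] (mod (p - 1))"
      unfolding pn by (simp add: Cong.cong_def mult_mod_right[symmetric])
    then have "[int g ^ (i * (2 * d)) = int g ^ (j * (2 * d))] (mod int p)"
      unfolding gen by (simp add: mult.commute)
    then have "[a ^ (2 * d) = b ^ (2 * d)] (mod int p)"
      using cong_pow[OF i, of "2 * d"] cong_pow[OF j, of "2 * d"] cong_sym cong_trans
      unfolding power_mult[symmetric] by meson
    then show False using ne by (simp add: cong_iff_dvd_diff)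
  qed
  define \<omega> where "\<omega> = cis (2 * pi / real n)"
  define Z where "Z = {z :: complex. z ^ n = - 1}"
  define S where "S = (\<Sum>z\<in>Z. z ^ i * cnj z ^ j)"
  have "(\<Sum>f\<in>odd_characters p m. char_ext p f a * cnj (char_ext p f b)) =
      (\<Sum>f\<in>odd_characters p m. char_ext p f (int g) ^ i * cnj (char_ext p f (int g)) ^ j)"
  proof (rule sum.cong)
    fix f assume "f \<in> odd_characters p m"
    then have f: "f \<in> mult_characters p"
      by (simp add: odd_characters_def characters_trivial_on_index_def)
    show "char_ext p f a * cnj (char_ext p f b) =
        char_ext p f (int g) ^ i * cnj (char_ext p f (int g)) ^ j"
      unfolding char_ext_cong[OF i, of f] char_ext_cong[OF j, of f] char_ext_power[OF assms(1) f]
      by simp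
  qed simp
  also have "\<dots> = S"
    unfolding S_def Z_def n_def
    using sum.reindex_bij_betw[OF bij, of "\<lambda>z. z ^ i * cnj z ^ j"] by simp
  finally have eq: "(\<Sum>f\<in>odd_characters p m. char_ext p f a * cnj (char_ext p f b)) = S" .
  have w: "\<omega> ^ n = 1" using cis_power_eq_iff[OF n, of n 0] by (simp add: \<omega>_def Cong.cong_def)
  have w0: "\<omega> \<noteq> 0" "\<omega> * cnj \<omega> = 1" by (simp_all add: \<omega>_def complex_mult_cnj flip: cis_cnj) 
  have bijw: "bij_betw (\<lambda>z. \<omega> * z) Z Z"
    by (rule bij_betw_byWitness[of _ "\<lambda>z. cnj \<omega> * z"])
       (use w w0 in \<open>auto simp: Z_def power_mult_distrib mult.assoc[symmetric] mult.commute[of "cnj \<omega>"] simp flip: complex_cnj_power\<close>)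
  have "S = (\<Sum>z\<in>Z. (\<omega> * z) ^ i * cnj (\<omega> * z) ^ j)"
    unfolding S_def using sum.reindex_bij_betw[OF bijw, of "\<lambda>z. z ^ i * cnj z ^ j"] by simp
  also have "\<dots> = \<omega> ^ i * cnj \<omega> ^ j * S"
    unfolding S_def by (simp add: sum_distrib_left power_mult_distrib mult_ac)
  finally have "S = 0 \<or> \<omega> ^ i * cnj \<omega> ^ j = 1" by simp
  moreover have "\<omega> ^ i * cnj \<omega> ^ j \<noteq> 1"
  proof
    assume "\<omega> ^ i * cnj \<omega> ^ j = 1"
    then have "\<omega> ^ i * (cnj \<omega> ^ j * \<omega> ^ j) = \<omega> ^ j" by (simp add: mult.assoc[symmetric])
    then have "\<omega> ^ i = \<omega> ^ j" using w0 by (simp add: mult.commute flip: power_mult_distrib)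
    then show False using nij cis_power_eq_iff[OF n] unfolding \<omega>_def by blast
  qed
  ultimately show ?thesis using eq by simp
qed

text \<open>Modulo 2 the residues 1 and -1 coincide. The prime 2 is therefore treated separately at
  the end.\<close>

lemma odd_characters_2: "m dvd 1 \<Longrightarrow> odd_characters 2 m = {}"
proof -
  have "char_ext 2 f (- 1) = 1" if "f \<in> mult_characters 2" for f
    using char_ext_1[OF two_is_prime_nat that] char_ext_cong[of "- 1" 1 2 f] by (simp add: Cong.cong_def)
  then show ?thesis
    by (force simp: odd_characters_def characters_trivial_on_index_def)
qed

section \<open>Truncation of the L-series\<close>

text \<open>The substitution \<open>n \<mapsto> p - n\<close> turns the sum into its
  negative.\<close>

lemma char_ext_sum_period:
  assumes p: "prime p" and f: "f \<in> mult_characters p" and odd: "char_ext p f (- 1) = - 1"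
  shows "(\<Sum>n<p. char_ext p f (int n)) = 0"
proof -
  have p0: "p > 0" using p by (rule prime_gt_0_nat)
  have "(\<Sum>n<p. char_ext p f (int n)) = (\<Sum>n\<in>{1..<p}. char_ext p f (int n))"
    using p0 char_ext_eq_0_iff[OF p f, of 0]
    by (simp add: lessThan_atLeast0 sum.atLeast_Suc_lessThan)
  also have "\<dots> = (\<Sum>n\<in>{1..<p}. char_ext p f (int (p - n)))"
    by (rule sum.reindex_bij_witness[of _ "\<lambda>n. p - n" "\<lambda>n. p - n"]) auto
  also have "\<dots> = (\<Sum>n\<in>{1..<p}. - char_ext p f (int n))"
  proof (rule sum.cong)
    fix n assume "n \<in> {1..<p}"
    then have "[int (p - n) = (- 1) * int n] (mod int p)"
      by (simp add: Cong.cong_def of_nat_diff mod_simps)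
    then have "char_ext p f (int (p - n)) = char_ext p f ((- 1) * int n)"
      by (rule char_ext_cong)
    then show "char_ext p f (int (p - n)) = - char_ext p f (int n)"
      unfolding char_ext_mult[OF p f] odd by simp
  qed simp
  also have "\<dots> = - (\<Sum>n\<in>{1..<p}. char_ext p f (int n))" by (rule sum_negf)
  also have "(\<Sum>n\<in>{1..<p}. char_ext p f (int n)) = (\<Sum>n<p. char_ext p f (int n))"
    using p0 char_ext_eq_0_iff[OF p f, of 0]
    by (simp add: lessThan_atLeast0 sum.atLeast_Suc_lessThan)
  finally show ?thesis by simp
qed

text \<open>Complete periods cancel and at most \<open>p\<close> terms of absolute value at most 1
  remain. This trivial bound suffices because the series is cut as late as
  \<open>p^2\<close>.\<close>

lemma char_ext_partial_sum_bound:
  assumes p: "prime p" and f: "f \<in> mult_characters p" and odd: "char_ext p f (- 1) = - 1"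
  shows "norm (\<Sum>n<N. char_ext p f (int n)) \<le> real p"
proof (induction N rule: less_induct)
  case (less N)
  show ?case
  proof (cases "N \<le> p")
    case True
    have "norm (\<Sum>n<N. char_ext p f (int n)) \<le> (\<Sum>n<N. 1)"
      by (rule sum_norm_le) (simp add: norm_char_ext_le[OF p f])
    then show ?thesis using True by simp
  next
    case False
    have "(\<Sum>n<N. char_ext p f (int n)) = 
       (\<Sum>n<p. char_ext p f (int n)) + (\<Sum>n\<in>{p..<N}. char_ext p f (int n))"
      using False by (simp add: lessThan_atLeast0 sum.atLeastLessThan_concat)
    also have "(\<Sum>n\<in>{p..<N}. char_ext p f (int n)) = (\<Sum>n<N - p. char_ext p f (int (n + p)))"
      using False by (intro sum.reindex_bij_witness[of _ "\<lambda>n. n + p" "\<lambda>n. n - p"]) auto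
    also have "\<dots> = (\<Sum>n<N - p. char_ext p f (int n))"
      by (intro sum.cong char_ext_cong) (simp_all add: Cong.cong_def)
    finally show ?thesis
      using less[of "N - p"] False prime_gt_0_nat[OF p] char_ext_sum_period[OF assms] by simp
  qed
qed

lemma sums_inverse_prods: "(\<lambda>n. 1 / (real (n + N + 1) * real (n + N + 2))) sums (1 / real (N + 1))"
proof -
  have "(\<lambda>n. 1 / real (n + N + 1)) \<longlonglongrightarrow> 0"
    using LIMSEQ_ignore_initial_segment[OF LIMSEQ_inverse_real_of_nat, of N]
    by (simp add: field_simps)
  then have "(\<lambda>n. 1 / real (n + N + 1) - 1 / real (Suc n + N + 1)) sums (1 / real (0 + N + 1) - 0)"
    by (rule telescope_sums')
  then show ?thesis
    by (simp add: field_simps)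
qed

text \<open>A single step of summation by parts: \<open>c\<close> is an increment of the partial
  sums, the first summand on the right gives an absolutely convergent series, the second
  telescopes.\<close>

lemma divide_by_parts:
  fixes x y :: complex
  assumes "y = x + 1" "x \<noteq> 0" "y \<noteq> 0" "c = a' - a"
  shows "c / x = a' / (x * y) + (a' / y - a / x)"
proof -
  have "a' / (x * y) + a' / y = a' * (1 + x) / (x * y)"
    using assms(2,3) by (simp add: field_simps)
  also have "\<dots> = a' / x" using assms by (simp add: add.commute)
  finally show ?thesis using assms(4) by (simp add: diff_divide_distrib)
qed

text \<open>Summation by parts turns the conditionally convergent series into the absolutely convergent
  \<open>\<Sum> A n / (n (n + 1))\<close>, where \<open>A n\<close> are the partial sums of the coefficients.\<close>

lemma Dirichlet_series_at_1_tail: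
  fixes f :: "nat \<Rightarrow> complex"
  assumes B: "\<And>n. norm (\<Sum>k<n. f k) \<le> B"
  shows "norm ((\<Sum>n. f (Suc n) / of_nat (Suc n)) - (\<Sum>n<N. f (Suc n) / of_nat (Suc n)))
    \<le> 4 * B / real (N + 1)"
proof -
  define A where "A n = (\<Sum>k<n. f (Suc k))" for n
  have B0: "B \<ge> 0" using B[of 0] by simp
  \<comment> \<open>\<open>A\<close> omits the term \<open>f 0\<close>, which the hypothesis
    includes; removing it costs another \<open>B\<close>.\<close>
  have A: "norm (A n) \<le> 2 * B" for n
  proof -
    have "(\<Sum>k<Suc n. f k) = f 0 + A n"
      by (simp only: sum.lessThan_Suc_shift A_def)
    moreover have "(\<Sum>k<1. f k) = f 0" by simp
    ultimately have "A n = (\<Sum>k<Suc n. f k) - (\<Sum>k<1. f k)"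
      by (simp only: add_diff_cancel_left')
    then have "norm (A n) \<le> norm (\<Sum>k<Suc n. f k) + norm (\<Sum>k<1. f k)"
      by (simp only: norm_triangle_ineq4)
    also have "\<dots> \<le> B + B" by (intro add_mono B)
    finally show ?thesis by simp
  qed
  define b where "b n = A (Suc n) / of_nat (Suc n * (n + 2))" for n
  define u where "u n = A n / of_nat (Suc n)" for n
  have split: "f (Suc n) / of_nat (Suc n) = b n + (u (Suc n) - u n)" for n
  proof -
    have 1: "of_nat (n + 1) \<noteq> (0 :: complex)" "of_nat (n + 2) \<noteq> (0 :: complex)"
      unfolding of_nat_eq_0_iff by simp_all
    have "A (Suc n) = A n + f (Suc n)" by (simp add: A_def)
    then show ?thesis
      using 1 divide_by_parts[of "of_nat (n + 2)" "of_nat (n + 1)" "f (Suc n)" "A (Suc n)" "A n"]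
      unfolding b_def u_def of_nat_mult by simp
  qed
  have norm_b: "norm (b n) \<le> 2 * B * (1 / (real (n + 1) * real (n + 2)))" for n
  proof -
    have "norm (b n) = norm (A (Suc n)) / real (Suc n * (n + 2))"
      unfolding b_def norm_divide norm_of_nat ..
    also have "\<dots> \<le> 2 * B / real (Suc n * (n + 2))"
      by (intro divide_right_mono A) simp
    finally show ?thesis by (simp add: algebra_simps)
  qed
  have sums: "(\<lambda>n. 2 * B * (1 / (real (n + M + 1) * real (n + M + 2)))) sums (2 * B * (1 / real (M + 1)))" for M
    by (intro sums_mult sums_inverse_prods)
  have "summable (\<lambda>n. norm (b n))"
    by (rule summable_comparison_test'[OF sums_summable[OF sums[of 0]], of 0])
       (use norm_b in simp)
  then have sb: "summable b" by (rule summable_norm_cancel)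
  have u0: "u \<longlonglongrightarrow> 0"
  proof (rule Lim_null_comparison)
    show "\<forall>\<^sub>F n in sequentially. norm (u n) \<le> 2 * B * inverse (real (Suc n))"
      using A unfolding u_def norm_divide norm_of_nat by (simp add: divide_simps)
    show "(\<lambda>n. 2 * B * inverse (real (Suc n))) \<longlonglongrightarrow> 0"
      using tendsto_mult_right_zero[OF LIMSEQ_inverse_real_of_nat] by blast
  qed
  have "(\<lambda>n. b n + (u (Suc n) - u n)) sums (suminf b + (0 - u 0))"
    by (intro sums_add telescope_sums u0 summable_sums sb)
  then have L: "(\<Sum>n. f (Suc n) / of_nat (Suc n)) = suminf b"
    unfolding split by (simp add: sums_iff u_def A_def)
  have "(\<Sum>n<N. f (Suc n) / of_nat (Suc n)) = sum b {..<N} + u N"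
    unfolding split sum.distrib sum_lessThan_telescope by (simp add: u_def A_def)
  then have eq: "(\<Sum>n. f (Suc n) / of_nat (Suc n)) - (\<Sum>n<N. f (Suc n) / of_nat (Suc n)) =
      (\<Sum>n. b (n + N)) - u N"
    unfolding L using suminf_split_initial_segment[OF sb, of N] by simp
  have "norm (\<Sum>n. b (n + N)) \<le> 2 * B * (1 / real (N + 1))"
  proof -
    have "norm (b (n + N)) \<le> 2 * B * (1 / (real (n + N + 1) * real (n + N + 2)))" for n
      using norm_b[of "n + N"] by simp
    then have "norm (\<Sum>n. b (n + N)) \<le> (\<Sum>n. 2 * B * (1 / (real (n + N + 1) * real (n + N + 2))))"
      by (intro norm_suminf_le sums_summable[OF sums])
    then show ?thesis using sums_unique[OF sums[of N]] by simp
  qed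
  moreover have "norm (u N) \<le> 2 * B / real (N + 1)"
    using A[of N] unfolding u_def norm_divide norm_of_nat by (simp add: divide_simps)
  ultimately show ?thesis
    unfolding eq using norm_triangle_ineq4[of "\<Sum>n. b (n + N)" "u N"] by simp
qed

lemma L_one_tail:
  assumes p: "prime p" and f: "f \<in> odd_characters p m"
  shows "norm (L_one p f - (\<Sum>n\<in>{1..N}. char_ext p f (int n) / of_nat n)) \<le> 4 * real p / real (N + 1)"
proof -
  have "f \<in> mult_characters p" "char_ext p f (- 1) = - 1"
    using f by (simp_all add: odd_characters_def characters_trivial_on_index_def)
  then have "norm (\<Sum>k<n. char_ext p f (int k)) \<le> real p" for n
    by (rule char_ext_partial_sum_bound[OF p])
  then have "norm (L_one p f - (\<Sum>n<N. char_ext p f (int (Suc n)) / of_nat (Suc n))) \<le> 4 * real p / real (N + 1)"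
    unfolding L_one_def by (rule Dirichlet_series_at_1_tail)
  also have "(\<Sum>n<N. char_ext p f (int (Suc n)) / of_nat (Suc n)) =
      (\<Sum>n\<in>{1..N}. char_ext p f (int n) / of_nat n)"
    by (rule sum.reindex_bij_witness[of _ "\<lambda>n. n - 1" Suc]) auto
  finally show ?thesis .
qed

section \<open>Mean values of divisor functions\<close>

definition factor_lists :: "nat \<Rightarrow> nat \<Rightarrow> nat list set" where
  "factor_lists k n = {xs. length xs = k \<and> (\<forall>x \<in> set xs. x > 0) \<and> prod_list xs = n}"

lemma divisor_tau_eq: "divisor_tau k n = card (factor_lists k n)"
  by (simp add: divisor_tau_def factor_lists_def)

lemma factor_lists_subset:
  assumes "n > 0"
  shows "factor_lists k n \<subseteq> {xs. set xs \<subseteq> {1..n} \<and> length xs = k}"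
proof -
  have "x dvd prod_list xs" if "x \<in> set xs" for xs and x :: nat
    using that by (induction xs) auto
  then have "x \<le> n" if "xs \<in> factor_lists k n" "x \<in> set xs" for xs x
    using that assms by (auto simp: factor_lists_def intro!: dvd_imp_le)
  then show ?thesis by (auto simp: factor_lists_def Suc_le_eq)
qed

lemma finite_factor_lists: "n > 0 \<Longrightarrow> finite (factor_lists k n)"
  by (erule finite_subset[OF factor_lists_subset]) (simp add: finite_lists_length_eq)

lemma divisor_tau_0: "divisor_tau 0 n = (if n = 1 then 1 else 0)"
proof -
  have "factor_lists 0 n = (if n = 1 then {[]} else {})"
    by (auto simp: factor_lists_def)
  then show ?thesis by (simp add: divisor_tau_eq)
qed

text \<open>Splitting off the first factor of a list: Dirichlet convolution with the constant
  function 1.\<close>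

lemma divisor_tau_Suc:
  assumes "n > 0"
  shows "divisor_tau (Suc k) n = (\<Sum>d | d dvd n. divisor_tau k (n div d))"
proof -
  have "factor_lists (Suc k) n = (\<Union>d\<in>{d. d dvd n}. (#) d ` factor_lists k (n div d))"
  proof (intro equalityI subsetI)
    fix xs assume "xs \<in> factor_lists (Suc k) n"
    then obtain d ys where xs: "xs = d # ys" "length ys = k" "d > 0" "\<forall>x\<in>set ys. x > 0" "d * prod_list ys = n"
      by (auto simp: factor_lists_def length_Suc_conv)
    then have "ys \<in> factor_lists k (n div d)" "d dvd n" by (auto simp: factor_lists_def)
    then show "xs \<in> (\<Union>d\<in>{d. d dvd n}. (#) d ` factor_lists k (n div d))" using xs by blast
  next
    fix xs assume "xs \<in> (\<Union>d\<in>{d. d dvd n}. (#) d ` factor_lists k (n div d))"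
    then show "xs \<in> factor_lists (Suc k) n"
      using assms by (auto simp: factor_lists_def intro!: Nat.gr0I)
  qed
  also have "card \<dots> = (\<Sum>d\<in>{d. d dvd n}. card ((#) d ` factor_lists k (n div d)))"
  proof (intro card_UN_disjoint ballI impI)
    fix d assume "d \<in> {d. d dvd n}"
    then have "n div d > 0" using assms by auto
    then show "finite ((#) d ` factor_lists k (n div d))"
      by (intro finite_imageI finite_factor_lists)
  qed (use assms in auto)
  also have "\<dots> = (\<Sum>d | d dvd n. divisor_tau k (n div d))"
    by (intro sum.cong refl) (simp add: card_image divisor_tau_eq)
  finally show ?thesis by (simp add: divisor_tau_eq)
qed

text \<open>Every divisor of \<open>a * b\<close> is a divisor of \<open>a\<close> times one of
  \<open>b\<close>. Without coprimality a divisor may arise from several pairs, so summing over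
  pairs only overcounts.\<close>

lemma divisor_tau_mult_le:
  "a > 0 \<Longrightarrow> b > 0 \<Longrightarrow> divisor_tau k (a * b) \<le> divisor_tau k a * divisor_tau k b"
proof (induction k arbitrary: a b)
  case 0
  then show ?case by (simp add: divisor_tau_0)
next
  case (Suc k)
  let ?A = "{d. d dvd a}" and ?B = "{d. d dvd b}"
  have fin: "finite ?A" "finite ?B" using Suc.prems by auto
  have "{d. d dvd a * b} \<subseteq> (\<lambda>(x, y). x * y) ` (?A \<times> ?B)"
  proof
    fix d assume "d \<in> {d. d dvd a * b}"
    then obtain x y where "d = x * y" "x dvd a" "y dvd b"
      using division_decomp by blast
    then show "d \<in> (\<lambda>(x, y). x * y) ` (?A \<times> ?B)"
      by (intro image_eqI[of _ _ "(x, y)"]) auto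
  qed
  then have "divisor_tau (Suc k) (a * b) \<le> (\<Sum>d\<in>(\<lambda>(x, y). x * y) ` (?A \<times> ?B). divisor_tau k (a * b div d))"
    unfolding divisor_tau_Suc[OF mult_pos_pos[OF Suc.prems]] using fin by (intro sum_mono2) auto
  also have "\<dots> \<le> (\<Sum>z\<in>?A \<times> ?B. divisor_tau k (a * b div (case z of (x, y) \<Rightarrow> x * y)))"
    using fin by (intro sum_image_le[unfolded comp_def]) auto
  also have "\<dots> \<le> (\<Sum>z\<in>?A \<times> ?B. divisor_tau k (a div fst z) * divisor_tau k (b div snd z))"
  proof (intro sum_mono)
    fix z assume "z \<in> ?A \<times> ?B"
    then obtain x y where z: "z = (x, y)" "x dvd a" "y dvd b" by auto
    then have "a * b div (x * y) = (a div x) * (b div y)" by (simp add: div_mult_div_if_dvd)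
    moreover have "a div x > 0" "b div y > 0"
      using z Suc.prems by auto
    ultimately show "divisor_tau k (a * b div (case z of (x, y) \<Rightarrow> x * y)) \<le>
        divisor_tau k (a div fst z) * divisor_tau k (b div snd z)"
      using Suc.IH z by simp
  qed
  also have "\<dots> = divisor_tau (Suc k) a * divisor_tau (Suc k) b"
    unfolding divisor_tau_Suc[OF Suc.prems(1)] divisor_tau_Suc[OF Suc.prems(2)] sum_product sum.cartesian_product
    by (simp add: case_prod_beta)
  finally show ?case .
qed

text \<open>Each convolution with 1 costs one factor \<Sum> \<open>G n * w n\<close>: write
  \<open>n = d * e\<close>, separate the variables by submultiplicativity of \<open>G\<close>, and
  relax \<open>d * e \<le> X\<close> to \<open>d, e \<le> X\<close>. The free function
  \<open>G\<close> allows a second divisor function to be carried along.\<close>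

lemma sum_multiplicative_divisor_tau_le:
  fixes w :: "nat \<Rightarrow> real"
  assumes w0: "\<And>n. w n \<ge> 0" and wm: "\<And>a b. w (a * b) = w a * w b" and w1: "w 1 = 1"
    and G: "\<And>n. G n \<ge> 0" "\<And>a b. a > 0 \<Longrightarrow> b > 0 \<Longrightarrow> G (a * b) \<le> G a * G b" "G 1 \<le> 1"
  shows "(\<Sum>n\<in>{1..X}. real (divisor_tau j n) * G n * w n) \<le> (\<Sum>n\<in>{1..X}. G n * w n) ^ j"
proof (induction j)
  case 0
  have "(\<Sum>n\<in>{1..X}. real (divisor_tau 0 n) * G n * w n) = (\<Sum>n\<in>{1..X}. if n = 1 then G 1 * w 1 else 0)"
    by (intro sum.cong) (auto simp: divisor_tau_0)
  also have "\<dots> \<le> 1" using G(3) w1 by (simp add: sum.delta)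
  finally show ?case by simp
next
  case (Suc j)
  let ?T = "SIGMA n:{1..X}. {d. d dvd n}"
  have "(\<Sum>n\<in>{1..X}. real (divisor_tau (Suc j) n) * G n * w n) =
      (\<Sum>n\<in>{1..X}. \<Sum>d | d dvd n. real (divisor_tau j (n div d)) * G n * w n)"
    by (intro sum.cong refl) (simp add: divisor_tau_Suc sum_distrib_right)
  also have "\<dots> = (\<Sum>(n, d)\<in>?T. real (divisor_tau j (n div d)) * G n * w n)"
    by (rule sum.Sigma) auto
  \<comment> \<open>The pair \<open>(d, n div d)\<close> recovers \<open>n\<close> as its product,
    so the reindexing is injective.\<close>
  also have "\<dots> = (\<Sum>(d, e)\<in>(\<lambda>(n, d). (d, n div d)) ` ?T. real (divisor_tau j e) * G (d * e) * w (d * e))"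
    by (subst sum.reindex) (auto simp: inj_on_def intro!: sum.cong)
  also have "\<dots> \<le> (\<Sum>(d, e)\<in>{1..X} \<times> {1..X}. real (divisor_tau j e) * G (d * e) * w (d * e))"
  proof (intro sum_mono2)
    show "(\<lambda>(n, d). (d, n div d)) ` ?T \<subseteq> {1..X} \<times> {1..X}"
    proof clarify
      fix n d assume n: "n \<in> {1..X}" and dn: "d dvd n"
      then have "0 < d" "0 < n div d" "d \<le> n" "n div d \<le> n" by (auto dest: dvd_imp_le intro: Nat.gr0I)
      then show "d \<in> {1..X} \<and> n div d \<in> {1..X}"
        using n by (auto intro: order_trans[OF div_le_dividend])
    qed
  qed (auto intro!: mult_nonneg_nonneg w0 G)
  also have "\<dots> \<le> (\<Sum>(d, e)\<in>{1..X} \<times> {1..X}. (G d * w d) * (real (divisor_tau j e) * G e * w e))"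
  proof (intro sum_mono, clarify)
    fix d e assume "d \<in> {1..X}" "e \<in> {1..X}"
    then have "G (d * e) \<le> G d * G e" by (intro G(2)) auto
    then have "real (divisor_tau j e) * G (d * e) * w (d * e) \<le> real (divisor_tau j e) * (G d * G e) * w (d * e)"
      by (intro mult_right_mono mult_left_mono w0) auto
    then show "real (divisor_tau j e) * G (d * e) * w (d * e) \<le> (G d * w d) * (real (divisor_tau j e) * G e * w e)"
      by (simp add: wm mult_ac)
  qed
  also have "\<dots> = (\<Sum>d\<in>{1..X}. G d * w d) * (\<Sum>e\<in>{1..X}. real (divisor_tau j e) * G e * w e)"
    unfolding sum_product sum.cartesian_product ..
  also have "\<dots> \<le> (\<Sum>d\<in>{1..X}. G d * w d) * (\<Sum>n\<in>{1..X}. G n * w n) ^ j"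
    by (intro mult_left_mono Suc sum_nonneg mult_nonneg_nonneg G w0)
  finally show ?case by simp
qed

text \<open>The previous bound is used twice: \<open>G = 1\<close> controls the mean of
  \<open>divisor_tau k\<close> by a \<open>k\<close>-th power, then \<open>G = divisor_tau k\<close>
  raises that to the power \<open>k\<close> again, whence the exponent
  \<open>k\<^sup>2\<close>.\<close>

lemma sum_divisor_tau_square_le:
  fixes w :: "nat \<Rightarrow> real"
  assumes w0: "\<And>n. w n \<ge> 0" and wm: "\<And>a b. w (a * b) = w a * w b" and w1: "w 1 = 1"
  shows "(\<Sum>n\<in>{1..X}. real (divisor_tau k n) ^ 2 * w n) \<le> (\<Sum>n\<in>{1..X}. w n) ^ k\<^sup>2"
proof -
  have tau1: "divisor_tau j 1 = 1" for j
  proof (induction j)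
    case (Suc j)
    have "{d :: nat. d dvd 1} = {1}" by auto
    then show ?case using Suc by (subst divisor_tau_Suc) simp_all
  qed (simp add: divisor_tau_0)
  have "(\<Sum>n\<in>{1..X}. real (divisor_tau k n) * 1 * w n) \<le> (\<Sum>n\<in>{1..X}. 1 * w n) ^ k"
    by (rule sum_multiplicative_divisor_tau_le) (use assms in auto)
  then have 1: "(\<Sum>n\<in>{1..X}. real (divisor_tau k n) * w n) \<le> (\<Sum>n\<in>{1..X}. w n) ^ k" by simp
  have "(\<Sum>n\<in>{1..X}. real (divisor_tau k n) ^ 2 * w n) =
      (\<Sum>n\<in>{1..X}. real (divisor_tau k n) * real (divisor_tau k n) * w n)"
    by (simp add: power2_eq_square)
  also have "\<dots> \<le> (\<Sum>n\<in>{1..X}. real (divisor_tau k n) * w n) ^ k"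
  proof (rule sum_multiplicative_divisor_tau_le)
    fix a b :: nat assume "a > 0" "b > 0"
    then show "real (divisor_tau k (a * b)) \<le> real (divisor_tau k a) * real (divisor_tau k b)"
      using divisor_tau_mult_le[of a b k] by (simp flip: of_nat_mult)
  qed (use w0 wm w1 tau1[of k] in simp_all)
  also have "\<dots> \<le> ((\<Sum>n\<in>{1..X}. w n) ^ k) ^ k"
    by (intro power_mono 1 sum_nonneg mult_nonneg_nonneg w0) auto
  finally show ?thesis by (simp add: power2_eq_square power_mult)
qed

text \<open>The coefficients of the \<open>k\<close>-th power of a Dirichlet polynomial of length
  \<open>N\<close>: the divisor function with all factors at most \<open>N\<close>.\<close>

definition bounded_tau :: "nat \<Rightarrow> nat \<Rightarrow> nat \<Rightarrow> nat" where
  "bounded_tau N k n = card {xs. set xs \<subseteq> {1..N} \<and> length xs = k \<and> prod_list xs = n}"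

lemma bounded_tau_le: "n > 0 \<Longrightarrow> bounded_tau N k n \<le> divisor_tau k n"
  unfolding bounded_tau_def divisor_tau_eq
  by (rule card_mono[OF finite_factor_lists]) (auto simp: factor_lists_def)

lemma bounded_tau_eq: "n > 0 \<Longrightarrow> n \<le> N \<Longrightarrow> bounded_tau N k n = divisor_tau k n"
proof -
  assume n: "n > 0" "n \<le> N"
  have "{xs. set xs \<subseteq> {1..N} \<and> length xs = k \<and> prod_list xs = n} = factor_lists k n"
    using factor_lists_subset[OF n(1), of k] n(2) by (fastforce simp: factor_lists_def)
  then show ?thesis by (simp add: bounded_tau_def divisor_tau_eq)
qed

text \<open>The power is a sum over lists of length \<open>k\<close>; complete multiplicativity
  makes each term depend on the product of the list alone, and the lists are grouped by it.\<close>

lemma sum_power_eq_bounded_tau: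
  fixes f :: "nat \<Rightarrow> 'a :: comm_semiring_1"
  assumes f1: "f 1 = 1" and fm: "\<And>a b. f (a * b) = f a * f b"
  shows "(\<Sum>x\<in>{1..N}. f x) ^ k = (\<Sum>n\<in>{1..N ^ k}. of_nat (bounded_tau N k n) * f n)"
proof -
  define L where "L k = {xs :: nat list. set xs \<subseteq> {1..N} \<and> length xs = k}" for k
  have fin: "finite (L k)" for k unfolding L_def by (rule finite_lists_length_eq) simp
  have "(\<Sum>x\<in>{1..N}. f x) ^ k = (\<Sum>xs\<in>L k. f (prod_list xs))"
  proof (induction k)
    case 0
    have "L 0 = {[]}" by (auto simp: L_def)
    then show ?case using f1 by simp
  next
    case (Suc k)
    have L: "L (Suc k) = (\<lambda>(x, xs). x # xs) ` ({1..N} \<times> L k)"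
      by (auto simp: L_def length_Suc_conv image_iff)
    have "(\<Sum>xs\<in>L (Suc k). f (prod_list xs)) = (\<Sum>(x, xs)\<in>{1..N} \<times> L k. f x * f (prod_list xs))"
      unfolding L by (subst sum.reindex) (auto simp: inj_on_def fm intro!: sum.cong)
    also have "\<dots> = (\<Sum>x\<in>{1..N}. f x) * (\<Sum>xs\<in>L k. f (prod_list xs))"
      unfolding sum_product sum.cartesian_product ..
    finally show ?case using Suc by simp
  qed
  also have "\<dots> = (\<Sum>n\<in>{1..N ^ k}. \<Sum>xs\<in>{xs \<in> L k. prod_list xs = n}. f (prod_list xs))"
  proof (rule sum.group[symmetric, OF fin])
    have "prod_list xs \<in> {1..N ^ length xs}" if "set xs \<subseteq> {1..N}" for xs
      using that
    proof (induction xs)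
      case (Cons x xs)
      then have "x * prod_list xs \<le> N * N ^ length xs" by (intro mult_mono) auto
      then show ?case using Cons by auto
    qed simp
    then show "prod_list ` L k \<subseteq> {1..N ^ k}" by (auto simp: L_def)
  qed simp
  also have "\<dots> = (\<Sum>n\<in>{1..N ^ k}. of_nat (bounded_tau N k n) * f n)"
    by (intro sum.cong refl) (simp add: bounded_tau_def L_def conj_assoc)
  finally show ?thesis .
qed

section \<open>Bounds for divisor sums and the tail of \<open>a(k)\<close>\<close>

lemma harmonic_sum_le:
  assumes "X > 0"
  shows "(\<Sum>n\<in>{1..X}. 1 / real n) \<le> 1 + ln (real X)"
  using assms
proof (induction X rule: nat_induct_non_zero)
  case (Suc n)
  have "ln (real n / real (Suc n)) \<le> real n / real (Suc n) - 1"
    using Suc by (intro ln_le_minus_one) simp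
  moreover have "real n / real (Suc n) - 1 = - (1 / real (Suc n))"
    by (simp add: field_simps)
  moreover have "ln (real n / real (Suc n)) = ln (real n) - ln (real (Suc n))"
    using Suc by (simp add: ln_div)
  ultimately have "1 / real (Suc n) \<le> ln (real (Suc n)) - ln (real n)" by linarith
  moreover have "(\<Sum>i\<in>{1..Suc n}. 1 / real i) = (\<Sum>i\<in>{1..n}. 1 / real i) + 1 / real (Suc n)"
    by simp
  ultimately show ?case using Suc.IH by linarith
qed simp

text \<open>This is \<zeta>(3/2) to the power \<open>k\<^sup>2\<close>; the term at 0 vanishes. The
  exponent 3/2 leaves a factor \<open>n^(-1/2)\<close> of \<open>n^(-2)\<close> to be spent on the
  tail.\<close>

definition tau_bound :: "nat \<Rightarrow> real" where
  "tau_bound k = (\<Sum>n. real n powr (- (3 / 2))) ^ k\<^sup>2"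

lemma tau_bound_nonneg: "tau_bound k \<ge> 0"
  unfolding tau_bound_def by (intro zero_le_power suminf_nonneg) (simp_all add: summable_real_powr_iff)

lemma sum_tau_square_powr_le:
  assumes "finite F" "0 \<notin> F"
  shows "(\<Sum>n\<in>F. real (divisor_tau k n) ^ 2 * real n powr (- (3 / 2))) \<le> tau_bound k"
proof -
  obtain X where X: "F \<subseteq> {1..X}"
    using assms by (metis One_nat_def Suc_leI atLeastAtMost_iff bot_nat_0.not_eq_extremum
        finite_nat_set_iff_bounded_le subsetI)
  have "(\<Sum>n\<in>F. real (divisor_tau k n) ^ 2 * real n powr (- (3 / 2))) \<le>
      (\<Sum>n\<in>{1..X}. real (divisor_tau k n) ^ 2 * real n powr (- (3 / 2)))"
    using X by (intro sum_mono2) auto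
  also have "\<dots> \<le> (\<Sum>n\<in>{1..X}. real n powr (- (3 / 2))) ^ k\<^sup>2"
    by (rule sum_divisor_tau_square_le) (simp_all add: powr_mult)
  also have "\<dots> \<le> tau_bound k"
    unfolding tau_bound_def
    by (intro power_mono sum_le_suminf sum_nonneg) (simp_all add: summable_real_powr_iff)
  finally show ?thesis .
qed

lemma tau_square_tail_term:
  assumes "0 < p" "p \<le> n"
  shows "real (divisor_tau k n) ^ 2 / real n ^ 2 \<le>
    real (divisor_tau k n) ^ 2 * real n powr (- (3 / 2)) * real p powr (- (1 / 2))"
proof -
  have "1 / real n ^ 2 = real n powr (- 2)"
    using assms by (simp add: powr_minus_divide powr_numeral)
  also have "\<dots> = real n powr (- (3 / 2)) * real n powr (- (1 / 2))"
    by (simp flip: powr_add)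
  also have "\<dots> \<le> real n powr (- (3 / 2)) * real p powr (- (1 / 2))"
    using assms by (intro mult_left_mono powr_mono2') auto
  finally have "real (divisor_tau k n) ^ 2 * (1 / real n ^ 2) \<le>
      real (divisor_tau k n) ^ 2 * (real n powr (- (3 / 2)) * real p powr (- (1 / 2)))"
    by (rule mult_left_mono) simp
  then show ?thesis by (simp add: mult.assoc)
qed

lemma summable_a_const: "summable (\<lambda>n. real (divisor_tau k (Suc n)) ^ 2 / real (Suc n) ^ 2)"
proof (rule bounded_imp_summable)
  show "(\<Sum>n\<le>m. real (divisor_tau k (Suc n)) ^ 2 / real (Suc n) ^ 2) \<le> tau_bound k" for m
  proof -
    have "(\<Sum>n\<le>m. real (divisor_tau k (Suc n)) ^ 2 / real (Suc n) ^ 2) =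
        (\<Sum>n\<in>{1..Suc m}. real (divisor_tau k n) ^ 2 / real n ^ 2)"
      by (rule sum.reindex_bij_witness[of _ "\<lambda>n. n - 1" Suc]) auto
    also have "\<dots> \<le> (\<Sum>n\<in>{1..Suc m}. real (divisor_tau k n) ^ 2 * real n powr (- (3 / 2)))"
      using tau_square_tail_term[of 1 _ k] by (intro sum_mono) auto
    also have "\<dots> \<le> tau_bound k" by (rule sum_tau_square_powr_le) auto
    finally show ?thesis .
  qed
qed simp

lemma sum_le_a_const: "(\<Sum>n\<in>{1..X}. real (divisor_tau k n) ^ 2 / real n ^ 2) \<le> a_const k"
proof -
  have "(\<Sum>n\<in>{1..X}. real (divisor_tau k n) ^ 2 / real n ^ 2) =
      (\<Sum>n<X. real (divisor_tau k (Suc n)) ^ 2 / real (Suc n) ^ 2)"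
    by (rule sum.reindex_bij_witness[of _ Suc "\<lambda>n. n - 1"]) auto
  also have "\<dots> \<le> a_const k"
    unfolding a_const_def by (intro sum_le_suminf summable_a_const) auto
  finally show ?thesis .
qed

lemma a_const_nonneg: "a_const k \<ge> 0"
  using sum_le_a_const[where X = 0] by simp

lemma a_const_tail:
  assumes "p > 0"
  shows "a_const k \<le> (\<Sum>n\<in>{1..<p}. real (divisor_tau k n) ^ 2 / real n ^ 2) + tau_bound k * real p powr (- (1 / 2))"
  unfolding a_const_def
proof (rule suminf_le_const[OF summable_a_const])
  fix m
  have "(\<Sum>n<m. real (divisor_tau k (Suc n)) ^ 2 / real (Suc n) ^ 2) =
      (\<Sum>n\<in>{1..m}. real (divisor_tau k n) ^ 2 / real n ^ 2)"
    by (rule sum.reindex_bij_witness[of _ "\<lambda>n. n - 1" Suc]) auto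
  also have "\<dots> \<le> (\<Sum>n\<in>{1..<p} \<union> {p..m}. real (divisor_tau k n) ^ 2 / real n ^ 2)"
    by (intro sum_mono2) auto
  also have "\<dots> = (\<Sum>n\<in>{1..<p}. real (divisor_tau k n) ^ 2 / real n ^ 2) +
      (\<Sum>n\<in>{p..m}. real (divisor_tau k n) ^ 2 / real n ^ 2)"
    by (intro sum.union_disjoint) auto
  also have "(\<Sum>n\<in>{p..m}. real (divisor_tau k n) ^ 2 / real n ^ 2) \<le>
      (\<Sum>n\<in>{p..m}. real (divisor_tau k n) ^ 2 * real n powr (- (3 / 2)) * real p powr (- (1 / 2)))"
    using assms by (intro sum_mono tau_square_tail_term) auto
  also have "\<dots> = (\<Sum>n\<in>{p..m}. real (divisor_tau k n) ^ 2 * real n powr (- (3 / 2))) * real p powr (- (1 / 2))"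
    by (simp add: sum_distrib_right)
  also have "\<dots> \<le> tau_bound k * real p powr (- (1 / 2))"
    using assms by (intro mult_right_mono sum_tau_square_powr_le) auto
  finally show "(\<Sum>n<m. real (divisor_tau k (Suc n)) ^ 2 / real (Suc n) ^ 2) \<le>
     (\<Sum>n\<in>{1..<p}. real (divisor_tau k n) ^ 2 / real n ^ 2) + tau_bound k * real p powr (- (1 / 2))"
    by simp
qed

text \<open>Below \<open>p\<close> nothing is lost: no \<open>n < p\<close> is a multiple of
  \<open>p\<close>, and since \<open>p \<le> N\<close> the restriction on the factors is void there.
  All other terms lie between 0 and those of \<open>a(k)\<close>, so the error is at most the tail
  of \<open>a(k)\<close> from \<open>p\<close> on.\<close>

lemma diagonal_approx:
  assumes p: "0 < p" "p \<le> N" and k: "k \<ge> 1"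
  shows "\<bar>(\<Sum>n\<in>{1..N ^ k}. if p dvd n then 0 else real (bounded_tau N k n) ^ 2 / real n ^ 2) - a_const k\<bar>
    \<le> tau_bound k * real p powr (- (1 / 2))"
proof -
  let ?S = "\<Sum>n\<in>{1..N ^ k}. if p dvd n then 0 else real (bounded_tau N k n) ^ 2 / real n ^ 2"
  have "?S \<le> (\<Sum>n\<in>{1..N ^ k}. real (divisor_tau k n) ^ 2 / real n ^ 2)"
    by (intro sum_mono) (auto intro!: divide_right_mono power_mono bounded_tau_le)
  also have "\<dots> \<le> a_const k" by (rule sum_le_a_const)
  finally have upper: "?S \<le> a_const k" .
  have NX: "N \<le> N ^ k" using p k by (intro self_le_power) auto
  have "(\<Sum>n\<in>{1..<p}. real (divisor_tau k n) ^ 2 / real n ^ 2) =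
      (\<Sum>n\<in>{1..<p}. if p dvd n then 0 else real (bounded_tau N k n) ^ 2 / real n ^ 2)"
    using p by (intro sum.cong) (auto simp: bounded_tau_eq dest: dvd_imp_le)
  also have "\<dots> \<le> ?S"
    using p NX by (intro sum_mono2) auto
  finally have "a_const k \<le> ?S + tau_bound k * real p powr (- (1 / 2))"
    using a_const_tail[OF p(1), of k] by linarith
  then show ?thesis using upper by linarith
qed

section \<open>Exceptional primes\<close>

text \<open>Counting primes costs one factor \<open>1 + ln a\<close> per variable, so the cube is the least integral
  exponent for which the total weight still converges.\<close>

definition log_weight :: "nat \<Rightarrow> real" where
  "log_weight n = 1 / (real n * (1 + ln (real n)) ^ 3)"

lemma one_plus_ln_ge_1: "n > 0 \<Longrightarrow> 1 + ln (real n) \<ge> 1"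
  by simp

lemma log_weight_nonneg: "log_weight n \<ge> 0"
  by (cases "n = 0") (simp_all add: log_weight_def)

text \<open>The square is what remains of the cube in \<open>log_weight\<close> after counting
  primes. Condensation reduces the series to that of the inverse squares.\<close>

lemma summable_log_weight: "summable (\<lambda>n. 1 / (real n * (1 + ln (real n)) ^ 2))"
proof (subst condensation_test)
  fix m :: nat assume m: "0 < m"
  then have "real m * (1 + ln (real m)) ^ 2 \<le> real (Suc m) * (1 + ln (real (Suc m))) ^ 2"
    by (intro mult_mono power_mono) auto
  then show "1 / (real (Suc m) * (1 + ln (real (Suc m))) ^ 2) \<le> 1 / (real m * (1 + ln (real m)) ^ 2)"
  proof (rule divide_left_mono)
    have "0 < 1 + ln (real m)" "0 < 1 + ln (real (Suc m))"
      using one_plus_ln_ge_1[OF m] one_plus_ln_ge_1[of "Suc m"] by linarith+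
    then show "0 < real (Suc m) * (1 + ln (real (Suc m))) ^ 2 * (real m * (1 + ln (real m)) ^ 2)"
      using m by (intro mult_pos_pos zero_less_power) auto
  qed simp
next
  have "summable (\<lambda>n. (1 / (ln 2)\<^sup>2) * (1 / real (Suc n) ^ 2))"
    using inverse_squares_sums by (intro summable_mult) (auto simp: sums_iff add.commute)
  then show "summable (\<lambda>n. 2 ^ n * (1 / (real (2 ^ n) * (1 + ln (real (2 ^ n))) ^ 2)))"
  proof (rule summable_comparison_test'[of _ 0])
    fix n :: nat
    \<comment> \<open>Since \<open>ln 2 \<le> 1\<close>, the constant 1 dominates the extra
      \<open>ln 2\<close>.\<close>
    have "ln 2 * real (Suc n) \<le> 1 + ln (real (2 ^ n))"
      using ln_le_minus_one[of "2 :: real"] by (simp add: ln_realpow algebra_simps)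
    then have "(ln 2 * real (Suc n)) ^ 2 \<le> (1 + ln (real (2 ^ n))) ^ 2"
      by (intro power_mono) auto
    then have "1 / (1 + ln (real (2 ^ n))) ^ 2 \<le> 1 / (ln 2 * real (Suc n)) ^ 2"
      by (intro frac_le zero_less_power mult_pos_pos) auto
    then show "norm (2 ^ n * (1 / (real (2 ^ n) * (1 + ln (real (2 ^ n))) ^ 2))) \<le>
        (1 / (ln 2)\<^sup>2) * (1 / real (Suc n) ^ 2)"
      by (simp add: power_mult_distrib)
  qed
qed simp

text \<open>The product of the primes divides \<open>N\<close>, and each of them is at least
  \<open>d + 1\<close>.\<close>

lemma card_prime_divisors_le:
  assumes "finite P" "\<And>p. p \<in> P \<Longrightarrow> prime p \<and> d < p \<and> p dvd N" "N > 0"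
  shows "real (card P) * ln (real d + 1) \<le> ln (real N)"
proof -
  have "\<Prod>P dvd N \<and> (d + 1) ^ card P \<le> \<Prod>P"
    using assms(1,2)
  proof (induction P rule: finite_induct)
    case (insert p P)
    have IH: "\<Prod>P dvd N" "(d + 1) ^ card P \<le> \<Prod>P"
      using insert.IH insert.prems by blast+
    have p: "prime p" "d + 1 \<le> p" "p dvd N" using insert.prems[of p] by auto
    have "coprime p q" if "q \<in> P" for q
      using that insert.hyps p(1) insert.prems[of q] by (intro primes_coprime) auto
    then have "coprime p (\<Prod>P)" by (rule prod_coprime_right)
    moreover have "(d + 1) * (d + 1) ^ card P \<le> p * \<Prod>P"
      using p IH by (intro mult_mono) auto
    ultimately show ?case using insert.hyps p IH by (simp add: divides_mult)
  qed simp
  then have "(d + 1) ^ card P \<le> N" using assms(3) by (meson dvd_imp_le le_trans)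
  then have "real ((d + 1) ^ card P) \<le> real N" by (rule of_nat_mono)
  then have "ln (real ((d + 1) ^ card P)) \<le> ln (real N)"
    by (subst ln_le_cancel_iff) (use assms(3) in auto)
  then show ?thesis by (simp add: ln_realpow add.commute)
qed

text \<open>The off-diagonal pairs left over by orthogonality. Integers are used so that the
  difference is not truncated.\<close>

definition power_coincidence :: "nat \<Rightarrow> nat \<Rightarrow> nat \<Rightarrow> nat \<Rightarrow> bool" where
  "power_coincidence p d a b \<longleftrightarrow> a \<noteq> b \<and> int p dvd int a ^ (2 * d) - int b ^ (2 * d)"

text \<open>The nonzero difference of the \<open>2 d\<close>-th powers is at most
  \<open>(a b)^(2 d)\<close>, and \<open>d dvd p - 1\<close> forces \<open>p > d\<close>. The second
  fact gains the logarithm in the denominator.\<close>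

lemma card_power_coincidence_le:
  assumes F: "finite F" and P: "\<And>p. p \<in> F \<Longrightarrow> prime p" and d: "d > 0" and a: "a > 0" and b: "b > 0"
  shows "real (card {p \<in> F. d dvd p - 1 \<and> power_coincidence p d a b}) \<le>
    2 * (real d / ln (real d + 1)) * ((1 + ln (real a)) * (1 + ln (real b)))"
proof (cases "a = b")
  case True
  then show ?thesis using a b d one_plus_ln_ge_1 by (simp add: power_coincidence_def)
next
  case False
  define A where "A = a ^ (2 * d)"
  define B where "B = b ^ (2 * d)"
  define N where "N = nat \<bar>int A - int B\<bar>"
  have AB: "A \<noteq> B" using False d by (simp add: A_def B_def power_eq_iff_eq_base)
  then have N: "N > 0" by (simp add: N_def)
  have pos: "A > 0" "B > 0" using a b by (simp_all add: A_def B_def)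
  have "A \<le> A * B" "B \<le> A * B" using pos by simp_all
  then have "N \<le> A * B" unfolding N_def by linarith
  also have "A * B = (a * b) ^ (2 * d)" by (simp add: A_def B_def power_mult_distrib)
  finally have "real N \<le> real ((a * b) ^ (2 * d))" by (rule of_nat_mono)
  then have "ln (real N) \<le> ln (real ((a * b) ^ (2 * d)))"
    using N by (intro ln_mono) auto
  also have "\<dots> = 2 * real d * (ln (real a) + ln (real b))"
    using a b by (simp add: ln_realpow ln_mult)
  \<comment> \<open>The sum of logarithms is replaced by a product so that the weighted sum over
    pairs factors.\<close>
  also have "\<dots> \<le> 2 * real d * ((1 + ln (real a)) * (1 + ln (real b)))"
    using a b by (intro mult_left_mono) (auto simp: algebra_simps)
  finally have lnN: "ln (real N) \<le> 2 * real d * ((1 + ln (real a)) * (1 + ln (real b)))" .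
  have "real (card {p \<in> F. d dvd p - 1 \<and> power_coincidence p d a b}) * ln (real d + 1) \<le> ln (real N)"
  proof (rule card_prime_divisors_le)
    fix p assume p: "p \<in> {p \<in> F. d dvd p - 1 \<and> power_coincidence p d a b}"
    then have "prime p" "d dvd p - 1" using P by auto
    then have "d < p" using prime_gt_1_nat[of p] by (auto dest!: dvd_imp_le)
    moreover have "int p dvd int N"
      using p by (simp add: power_coincidence_def N_def A_def B_def)
    ultimately show "prime p \<and> d < p \<and> p dvd N" using \<open>prime p\<close> by simp
  qed (use F N in auto)
  also note lnN
  finally show ?thesis
    using d by (simp add: field_simps)
qed

text \<open>Concavity: chords from the origin to the graph of \<open>ln (x + 1)\<close> flatten. It
  lets every \<open>d \<le> D\<close> be charged at the rate of \<open>D\<close>.\<close>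

lemma x_over_ln_mono:
  fixes x y :: real
  assumes "0 < x" "x \<le> y"
  shows "x / ln (x + 1) \<le> y / ln (y + 1)"
proof -
  have pos: "ln (x + 1) > 0" "ln (y + 1) > 0" using assms by simp_all
  have "ln ((y + 1) / (x + 1)) \<le> (y + 1) / (x + 1) - 1"
    using assms by (intro ln_le_minus_one) simp
  also have "\<dots> = (y - x) / (x + 1)" using assms by (simp add: field_simps)
  finally have 1: "ln (y + 1) \<le> ln (x + 1) + (y - x) / (x + 1)"
    using assms by (simp add: ln_div)
  have "ln (1 / (x + 1)) \<le> 1 / (x + 1) - 1"
    using assms by (intro ln_le_minus_one) simp
  then have 2: "x / (x + 1) \<le> ln (x + 1)"
    using assms by (simp add: ln_div field_simps)
  have "x * ln (y + 1) \<le> x * (ln (x + 1) + (y - x) / (x + 1))"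
    using 1 assms by (intro mult_left_mono) auto
  also have "\<dots> = x * ln (x + 1) + (y - x) * (x / (x + 1))" by (simp add: algebra_simps)
  also have "\<dots> \<le> x * ln (x + 1) + (y - x) * ln (x + 1)"
    using 2 assms by (intro add_left_mono mult_left_mono) auto
  finally have "x * ln (y + 1) \<le> y * ln (x + 1)" by (simp add: algebra_simps)
  then show ?thesis using pos by (simp add: field_simps)
qed

text \<open>No \<open>k\<close> occurs, and the length \<open>X\<close> is existentially quantified:
  outside this set the coincidences are light at every length, in particular at
  \<open>p^(2 k)\<close> for all \<open>k\<close> simultaneously.\<close>

definition exceptional_primes :: "real \<Rightarrow> real \<Rightarrow> nat set" where
  "exceptional_primes D R = {p. prime p \<and> (\<exists>d X. d > 0 \<and> real d \<le> D \<and> d dvd p - 1 \<and>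
     1 / R < (\<Sum>(a, b)\<in>{1..X} \<times> {1..X}. if power_coincidence p d a b then log_weight a * log_weight b else 0))}"

text \<open>Markov's inequality: each prime of \<open>F\<close> contributes more than
  \<open>1 / R\<close> to the total weight of coincidences, which is bounded by exchanging the sums
  and counting primes for fixed \<open>d\<close>, \<open>a\<close>, \<open>b\<close>. Finiteness of
  the whole set is not yet available, hence the finite \<open>F\<close>.\<close>

lemma exceptional_primes_finite_subset:
  assumes D: "D \<ge> 2" and R: "R > 0" and F: "finite F" "F \<subseteq> exceptional_primes D R"
  shows "real (card F) \<le> 2 * (\<Sum>n. 1 / (real n * (1 + ln (real n)) ^ 2))\<^sup>2 * (D\<^sup>2 * R / ln D)"
proof -
  let ?V = "\<Sum>n. 1 / (real n * (1 + ln (real n)) ^ 2)"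
  let ?w = "\<lambda>p d a b. if power_coincidence p d a b then log_weight a * log_weight b else 0"
  define exc where "exc p d X \<longleftrightarrow> d > 0 \<and> real d \<le> D \<and> d dvd p - 1 \<and>
      1 / R < (\<Sum>(a, b)\<in>{1..X} \<times> {1..X}. ?w p d a b)" for p d X
  have "\<forall>p\<in>F. \<exists>d X. exc p d X"
    using F(2) unfolding exceptional_primes_def exc_def by blast
  then obtain d Y where "\<And>p. p \<in> F \<Longrightarrow> exc p (d p) (Y p)" by metis
  note dY = this[unfolded exc_def]
  \<comment> \<open>A common length for all primes in \<open>F\<close>; lengthening only adds
    nonnegative terms.\<close>
  obtain X where X: "\<And>p. p \<in> F \<Longrightarrow> Y p \<le> X"
    using F(1) by (metis finite_imageI finite_nat_set_iff_bounded_le imageI)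
  define T where "T = {1..nat \<lfloor>D\<rfloor>}"
  have T: "e \<in> T \<longleftrightarrow> e > 0 \<and> real e \<le> D" for e
    using D by (simp add: T_def le_nat_iff le_floor_iff Suc_le_eq)
  let ?Q = "{1..X} \<times> {1..X}"
  have sum_Q: "(\<Sum>(a, b)\<in>?Q. q * (g a * g b)) = q * (\<Sum>a\<in>{1..X}. g a)\<^sup>2" for q :: real and g
  proof -
    have "(\<Sum>(a, b)\<in>?Q. q * (g a * g b)) = (\<Sum>a\<in>{1..X}. \<Sum>b\<in>{1..X}. q * (g a * g b))"
      by (rule sum.cartesian_product[symmetric])
    also have "\<dots> = q * (\<Sum>a\<in>{1..X}. g a)\<^sup>2"
      unfolding power2_eq_square sum_product by (simp only: sum_distrib_left)
    finally show ?thesis .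
  qed
  have "real (card F) * (1 / R) = (\<Sum>p\<in>F. 1 / R)" by simp
  also have "\<dots> \<le> (\<Sum>p\<in>F. \<Sum>e\<in>T. \<Sum>(a, b)\<in>?Q. if e dvd p - 1 then ?w p e a b else 0)"
  proof (intro sum_mono)
    fix p assume p: "p \<in> F"
    have "1 / R \<le> (\<Sum>(a, b)\<in>{1..Y p} \<times> {1..Y p}. ?w p (d p) a b)"
      using dY[OF p] by simp
    also have "\<dots> \<le> (\<Sum>(a, b)\<in>?Q. ?w p (d p) a b)"
      using X[OF p] by (intro sum_mono2) (auto simp: log_weight_nonneg split: if_splits)
    also have "\<dots> = (\<Sum>(a, b)\<in>?Q. if d p dvd p - 1 then ?w p (d p) a b else 0)"
      using dY[OF p] by simp
    \<comment> \<open>The divisor \<open>d p\<close> varies with \<open>p\<close>; summing over all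
      candidates makes the sum over primes exchangeable.\<close>
    also have "\<dots> \<le> (\<Sum>e\<in>T. \<Sum>(a, b)\<in>?Q. if e dvd p - 1 then ?w p e a b else 0)"
    proof (rule member_le_sum)
      show "d p \<in> T" using dY[OF p] T by blast
      show "0 \<le> (\<Sum>(a, b)\<in>?Q. if e dvd p - 1 then ?w p e a b else 0)" for e
        by (intro sum_nonneg) (auto simp: log_weight_nonneg split: if_splits)
    qed (simp add: T_def)
    finally show "1 / R \<le> (\<Sum>e\<in>T. \<Sum>(a, b)\<in>?Q. if e dvd p - 1 then ?w p e a b else 0)" .
  qed
  also have "\<dots> = (\<Sum>e\<in>T. \<Sum>p\<in>F. \<Sum>(a, b)\<in>?Q. if e dvd p - 1 then ?w p e a b else 0)"
    by (rule sum.swap)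
  also have "\<dots> = (\<Sum>e\<in>T. \<Sum>(a, b)\<in>?Q. \<Sum>p\<in>F. if e dvd p - 1 then ?w p e a b else 0)"
    by (intro sum.cong refl, subst sum.swap) (simp add: case_prod_beta)
  also have "\<dots> = (\<Sum>e\<in>T. \<Sum>(a, b)\<in>?Q.
      real (card {p \<in> F. e dvd p - 1 \<and> power_coincidence p e a b}) * (log_weight a * log_weight b))"
  proof (intro sum.cong refl, clarify)
    fix e a b
    have "(\<Sum>p\<in>F. if e dvd p - 1 then ?w p e a b else 0) =
        (\<Sum>p\<in>F. if e dvd p - 1 \<and> power_coincidence p e a b then log_weight a * log_weight b else 0)"
      by (intro sum.cong) auto
    also have "\<dots> = (\<Sum>p\<in>{p \<in> F. e dvd p - 1 \<and> power_coincidence p e a b}. log_weight a * log_weight b)"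
      by (simp only: sum.inter_filter[OF F(1)])
    finally show "(\<Sum>p\<in>F. if e dvd p - 1 then ?w p e a b else 0) =
        real (card {p \<in> F. e dvd p - 1 \<and> power_coincidence p e a b}) * (log_weight a * log_weight b)"
      by simp
  qed
  also have "\<dots> \<le> (\<Sum>e\<in>T. \<Sum>(a, b)\<in>?Q. 2 * (D / ln (D + 1)) *
      ((1 / (real a * (1 + ln (real a)) ^ 2)) * (1 / (real b * (1 + ln (real b)) ^ 2))))"
  proof (intro sum_mono, clarify)
    fix e a b assume e: "e \<in> T" and ab: "a \<in> {1..X}" "b \<in> {1..X}"
    have ln: "1 + ln (real a) \<ge> 1" "1 + ln (real b) \<ge> 1" using ab by auto
    have "real (card {p \<in> F. e dvd p - 1 \<and> power_coincidence p e a b}) \<le>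
        2 * (real e / ln (real e + 1)) * ((1 + ln (real a)) * (1 + ln (real b)))"
      using e T ab F by (intro card_power_coincidence_le) (auto simp: exceptional_primes_def)
    also have "\<dots> \<le> 2 * (D / ln (D + 1)) * ((1 + ln (real a)) * (1 + ln (real b)))"
      using e T ln by (intro mult_right_mono mult_left_mono x_over_ln_mono) auto
    finally have "real (card {p \<in> F. e dvd p - 1 \<and> power_coincidence p e a b}) * (log_weight a * log_weight b) \<le>
        2 * (D / ln (D + 1)) * ((1 + ln (real a)) * (1 + ln (real b))) * (log_weight a * log_weight b)"
      by (intro mult_right_mono mult_nonneg_nonneg log_weight_nonneg)
    also have "\<dots> = 2 * (D / ln (D + 1)) * (((1 + ln (real a)) * log_weight a) * ((1 + ln (real b)) * log_weight b))"
      by (simp only: mult_ac)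
    also have "(1 + ln (real a)) * log_weight a = 1 / (real a * (1 + ln (real a)) ^ 2)"
      using ln by (simp add: log_weight_def power3_eq_cube power2_eq_square)
    also have "(1 + ln (real b)) * log_weight b = 1 / (real b * (1 + ln (real b)) ^ 2)"
      using ln by (simp add: log_weight_def power3_eq_cube power2_eq_square)
    finally show "real (card {p \<in> F. e dvd p - 1 \<and> power_coincidence p e a b}) * (log_weight a * log_weight b) \<le>
        2 * (D / ln (D + 1)) * ((1 / (real a * (1 + ln (real a)) ^ 2)) * (1 / (real b * (1 + ln (real b)) ^ 2)))" .
  qed
  also have "\<dots> = real (card T) * (2 * (D / ln (D + 1)) * (\<Sum>a\<in>{1..X}. 1 / (real a * (1 + ln (real a)) ^ 2))\<^sup>2)"
    by (simp only: sum_Q[of "2 * (D / ln (D + 1))" "\<lambda>a. 1 / (real a * (1 + ln (real a)) ^ 2)"] sum_constant)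
  \<comment> \<open>One factor \<open>D\<close> counts the possible \<open>d\<close>, the other
    comes from the degree of the powers.\<close>
  also have "\<dots> \<le> D * (2 * (D / ln D) * ?V\<^sup>2)"
  proof (intro mult_mono power_mono divide_left_mono)
    show "real (card T) \<le> D" using D by (simp add: T_def of_nat_floor)
    show "(\<Sum>a\<in>{1..X}. 1 / (real a * (1 + ln (real a)) ^ 2)) \<le> ?V"
      by (intro sum_le_suminf summable_log_weight) auto
  qed (use D in \<open>auto intro!: sum_nonneg mult_nonneg_nonneg\<close>)
  finally have "real (card F) \<le> D * (2 * (D / ln D) * ?V\<^sup>2) * R"
    using R by (simp add: field_simps)
  then show ?thesis by (simp add: power2_eq_square mult_ac)
qed

text \<open>A bound valid for all finite subsets makes the set itself finite.\<close>

lemma exceptional_primes_bound: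
  obtains C where "\<And>D R. D \<ge> 2 \<Longrightarrow> R \<ge> 2 \<Longrightarrow> finite (exceptional_primes D R) \<and>
    real (card (exceptional_primes D R)) \<le> C * (D\<^sup>2 * R * (ln R)\<^sup>2 / ln D)"
proof
  let ?V = "\<Sum>n. 1 / (real n * (1 + ln (real n)) ^ 2)"
  fix D R :: real assume DR: "D \<ge> 2" "R \<ge> 2"
  let ?B = "2 * ?V\<^sup>2 * (D\<^sup>2 * R / ln D)"
  have B: "?B \<ge> 0" using DR by simp
  have *: "finite (exceptional_primes D R) \<and> card (exceptional_primes D R) \<le> nat \<lfloor>?B\<rfloor>"
  proof (rule finite_if_finite_subsets_card_bdd)
    fix G assume "G \<subseteq> exceptional_primes D R" "finite G"
    then have "real (card G) \<le> ?B"
      using DR by (intro exceptional_primes_finite_subset) auto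
    then show "card G \<le> nat \<lfloor>?B\<rfloor>" by (rule le_nat_floor)
  qed
  then have "real (card (exceptional_primes D R)) \<le> real (nat \<lfloor>?B\<rfloor>)" by simp
  also have "\<dots> \<le> ?B" using B by (rule of_nat_floor)
  \<comment> \<open>As \<open>R \<ge> 2\<close>, the factor \<open>(ln R)\<^sup>2\<close> can be
    inserted at the cost of \<open>1 / (ln 2)\<^sup>2\<close> in the constant.\<close>
  also have "?B = (2 * ?V\<^sup>2 / (ln 2)\<^sup>2) * (D\<^sup>2 * R * (ln 2)\<^sup>2 / ln D)" by simp
  also have "\<dots> \<le> (2 * ?V\<^sup>2 / (ln 2)\<^sup>2) * (D\<^sup>2 * R * (ln R)\<^sup>2 / ln D)"
    using DR by (intro mult_left_mono divide_right_mono power_mono) auto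
  finally show "finite (exceptional_primes D R) \<and> real (card (exceptional_primes D R)) \<le>
      (2 * ?V\<^sup>2 / (ln 2)\<^sup>2) * (D\<^sup>2 * R * (ln R)\<^sup>2 / ln D)"
    using * by blast
qed

section \<open>Moments\<close>

text \<open>Averaging the expanded power over the odd characters leaves a kernel
  \<open>K a b\<close>. It is 1 on the diagonal away from multiples of \<open>p\<close>, vanishes
  off the diagonal except at coincidences, and is bounded by 1 there.\<close>

lemma moment_expansion:
  fixes N k :: nat
  assumes p: "prime p" "p > 2" and m: "m dvd p - 1" "d = (p - 1) div m" "odd d"
  defines "S \<equiv> \<lambda>f. \<Sum>n\<in>{1..N}. char_ext p f (int n) / of_nat n"
    and "c \<equiv> \<lambda>n. real (bounded_tau N k n) / real n"
  shows "\<bar>2 / real m * (\<Sum>f\<in>odd_characters p m. norm (S f) ^ (2 * k)) -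
      (\<Sum>n\<in>{1..N ^ k}. if p dvd n then 0 else c n ^ 2)\<bar>
    \<le> (\<Sum>(a, b)\<in>{1..N ^ k} \<times> {1..N ^ k}. if power_coincidence p d a b then c a * c b else 0)"
proof -
  define Q where "Q = {1..N ^ k} \<times> {1..N ^ k}"
  define B where "B = odd_characters p m"
  define K where "K a b = 2 / of_nat m * (\<Sum>f\<in>B. char_ext p f (int a) * cnj (char_ext p f (int b)))" for a b
  note card = odd_characters_card[OF p m]
  have B: "f \<in> mult_characters p" if "f \<in> B" for f
    using that by (simp add: B_def odd_characters_def characters_trivial_on_index_def)
  have m2: "2 / real m * real (card B) = 1"
    using card(2,3) unfolding B_def by (simp add: field_simps flip: of_nat_mult)
  have m2_complex: "2 / of_nat m * of_nat (card B) = (1 :: complex)"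
    using arg_cong[OF m2, of complex_of_real] by simp
  have Sk: "complex_of_real (norm (S f) ^ (2 * k)) =
      (\<Sum>(a, b)\<in>Q. of_real (c a * c b) * (char_ext p f (int a) * cnj (char_ext p f (int b))))"
    if f: "f \<in> B" for f
  proof -
    have "S f ^ k = (\<Sum>n\<in>{1..N ^ k}. of_nat (bounded_tau N k n) * (char_ext p f (int n) / of_nat n))"
      unfolding S_def
      by (rule sum_power_eq_bounded_tau)
         (simp_all add: char_ext_1[OF p(1) B[OF f]] char_ext_mult[OF p(1) B[OF f]])
    also have "\<dots> = (\<Sum>n\<in>{1..N ^ k}. of_real (c n) * char_ext p f (int n))"
      by (simp add: c_def)
    finally have *: "S f ^ k = (\<Sum>n\<in>{1..N ^ k}. of_real (c n) * char_ext p f (int n))" .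
    have "complex_of_real (norm (S f) ^ (2 * k)) = complex_of_real ((norm (S f ^ k))\<^sup>2)"
      by (simp only: norm_power power_even_eq)
    also have "\<dots> = S f ^ k * cnj (S f ^ k)" by (simp only: complex_norm_square flip: of_real_power)
    also have "\<dots> = (\<Sum>a\<in>{1..N ^ k}. \<Sum>b\<in>{1..N ^ k}. of_real (c a * c b) *
        (char_ext p f (int a) * cnj (char_ext p f (int b))))"
      unfolding * cnj_sum sum_product by (simp add: mult_ac)
    finally show ?thesis by (simp add: Q_def sum.cartesian_product)
  qed
  have norm_K: "norm (K a b) \<le> 1" for a b
  proof -
    have "norm (\<Sum>f\<in>B. char_ext p f (int a) * cnj (char_ext p f (int b))) \<le> (\<Sum>f\<in>B. 1)"
      using norm_char_ext_le[OF p(1) B] by (intro sum_norm_le) (simp add: norm_mult mult_le_one)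
    then have "norm (K a b) \<le> 2 / real m * real (card B)"
      unfolding K_def norm_mult norm_divide by (simp add: divide_right_mono)
    then show ?thesis using m2 by simp
  qed
  have K_dvd: "K a b = 0" if "p dvd a \<or> p dvd b" for a b
  proof -
    have "char_ext p f (int a) * cnj (char_ext p f (int b)) = 0" if "f \<in> B" for f
      using \<open>p dvd a \<or> p dvd b\<close> char_ext_eq_0_iff[OF p(1) B[OF that]] by auto
    then have "(\<Sum>f\<in>B. char_ext p f (int a) * cnj (char_ext p f (int b))) = 0"
      by (intro sum.neutral ballI)
    then show ?thesis unfolding K_def by simp
  qed
  have K_diag: "K a a = 1" if "\<not> p dvd a" for a
  proof -
    have "char_ext p f (int a) * cnj (char_ext p f (int a)) = 1" if "f \<in> B" for f
      using \<open>\<not> p dvd a\<close> norm_char_ext[OF p(1) B[OF that], of "int a"]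
      by (simp flip: complex_norm_square)
    then have "(\<Sum>f\<in>B. char_ext p f (int a) * cnj (char_ext p f (int a))) = (\<Sum>f\<in>B. 1)"
      by (intro sum.cong refl)
    then show ?thesis unfolding K_def using m2_complex by simp
  qed
  have K_off: "K a b = 0" if "a \<noteq> b" "\<not> power_coincidence p d a b" for a b
  proof (cases "p dvd a \<or> p dvd b")
    case False
    then show ?thesis
      using odd_characters_orthogonal[OF p m, of "int a" "int b"] that
      by (simp add: K_def B_def power_coincidence_def)
  qed (rule K_dvd)
  have c0: "c n \<ge> 0" for n by (simp add: c_def)
  have "complex_of_real (2 / real m * (\<Sum>f\<in>B. norm (S f) ^ (2 * k))) =
      2 / of_nat m * (\<Sum>f\<in>B. \<Sum>(a, b)\<in>Q. of_real (c a * c b) * (char_ext p f (int a) * cnj (char_ext p f (int b))))"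
    by (simp add: Sk flip: of_real_power)
  also have "\<dots> = (\<Sum>(a, b)\<in>Q. of_real (c a * c b) * K a b)"
    unfolding K_def by (subst sum.swap) (simp add: sum_distrib_left case_prod_beta mult_ac)
  finally have 1: "complex_of_real (2 / real m * (\<Sum>f\<in>B. norm (S f) ^ (2 * k))) =
      (\<Sum>(a, b)\<in>Q. of_real (c a * c b) * K a b)" .
  \<comment> \<open>The diagonal is written as a double sum so that both sides can be compared pair
    by pair.\<close>
  have "(\<Sum>n\<in>{1..N ^ k}. if p dvd n then 0 else c n ^ 2) =
      (\<Sum>a\<in>{1..N ^ k}. \<Sum>b\<in>{1..N ^ k}. if a = b then (if p dvd a then 0 else c a ^ 2) else 0)"
    by (intro sum.cong refl) (simp add: sum.delta')
  also have "\<dots> = (\<Sum>(a, b)\<in>Q. if a = b then (if p dvd a then 0 else c a ^ 2) else 0)"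
    unfolding Q_def by (rule sum.cartesian_product)
  finally have 2: "complex_of_real (\<Sum>n\<in>{1..N ^ k}. if p dvd n then 0 else c n ^ 2) =
      (\<Sum>(a, b)\<in>Q. of_real (if a = b then (if p dvd a then 0 else c a ^ 2) else 0))"
    by (simp only: of_real_sum case_prod_unfold)
  have "\<bar>2 / real m * (\<Sum>f\<in>B. norm (S f) ^ (2 * k)) - (\<Sum>n\<in>{1..N ^ k}. if p dvd n then 0 else c n ^ 2)\<bar> =
    norm (complex_of_real (2 / real m * (\<Sum>f\<in>B. norm (S f) ^ (2 * k))) -
      complex_of_real (\<Sum>n\<in>{1..N ^ k}. if p dvd n then 0 else c n ^ 2))"
    by (simp only: norm_of_real flip: of_real_diff)
  also have "\<dots> = norm (\<Sum>(a, b)\<in>Q. of_real (c a * c b) * K a b -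
      of_real (if a = b then (if p dvd a then 0 else c a ^ 2) else 0))"
    unfolding 1 2 by (simp only: sum_subtractf case_prod_unfold)
  also have "\<dots> \<le> (\<Sum>(a, b)\<in>Q. if power_coincidence p d a b then c a * c b else 0)"
  proof (rule sum_norm_le, clarify)
    fix a b
    show "norm (of_real (c a * c b) * K a b - of_real (if a = b then (if p dvd a then 0 else c a ^ 2) else 0))
        \<le> (if power_coincidence p d a b then c a * c b else 0)"
    proof (cases "a = b")
      case True
      then have "of_real (c a * c b) * K a b = of_real (if a = b then (if p dvd a then 0 else c a ^ 2) else 0)"
        using K_dvd[of a a] K_diag[of a] by (simp add: power2_eq_square)
      then show ?thesis using c0 by simp
    next
      case False
      have "norm (of_real (c a * c b) * K a b) \<le> c a * c b * 1"
        unfolding norm_mult using c0 norm_K[of a b] by (intro mult_mono) (auto simp: norm_mult)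
      then show ?thesis using False K_off[OF False] by simp
    qed
  qed
  finally show ?thesis by (simp add: B_def Q_def)
qed

text \<open>Cauchy--Schwarz separates the divisor functions from the set of coincidences, so that the
  exceptional set does not depend on \<open>k\<close>; it costs the square root of \<open>R\<close>.\<close>

lemma off_diagonal_bound:
  assumes R: "R > 0" and X: "X > 0"
    and c: "\<And>n. n \<in> {1..X} \<Longrightarrow> 0 \<le> c n \<and> c n \<le> real (divisor_tau k n) / real n"
    and small: "(\<Sum>(a, b)\<in>{1..X} \<times> {1..X}. if P a b then log_weight a * log_weight b else 0) \<le> 1 / R"
  shows "(\<Sum>(a, b)\<in>{1..X} \<times> {1..X}. if P a b then c a * c b else 0)
    \<le> (1 + ln (real X)) ^ (k\<^sup>2 + 3) / sqrt R"
proof -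
  define l where "l = 1 + ln (real X)"
  define I where "I = {z \<in> {1..X} \<times> {1..X}. P (fst z) (snd z)}"
  have fin: "finite I" by (simp add: I_def)
  have l: "l \<ge> 1" using X by (simp add: l_def)
  have I: "(\<Sum>(a, b)\<in>{1..X} \<times> {1..X}. if P a b then g a * g b else 0) = (\<Sum>z\<in>I. g (fst z) * g (snd z))"
    for g :: "nat \<Rightarrow> real"
    unfolding I_def by (subst sum.inter_filter) (simp_all add: case_prod_beta)
  \<comment> \<open>\<open>r\<close> takes the part later compared with \<open>log_weight\<close>,
    \<open>t\<close> the divisor function; the product of their square roots is the original
    coefficient.\<close>
  define r where "r n = 1 / real n" for n
  define t where "t n = real (divisor_tau k n) ^ 2 * r n" for n
  have nonneg: "r n \<ge> 0" "t n \<ge> 0" for n by (simp_all add: r_def t_def)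
  have rt: "real (divisor_tau k n) / real n = sqrt (r n) * sqrt (t n)" for n
    by (simp add: r_def t_def real_sqrt_mult real_sqrt_divide)
  have "(\<Sum>z\<in>I. c (fst z) * c (snd z)) \<le>
      (\<Sum>z\<in>I. sqrt (r (fst z) * r (snd z)) * sqrt (t (fst z) * t (snd z)))"
  proof (rule sum_mono)
    fix z assume "z \<in> I"
    then have z: "fst z \<in> {1..X}" "snd z \<in> {1..X}" by (auto simp: I_def)
    have "c (fst z) * c (snd z) \<le> (sqrt (r (fst z)) * sqrt (t (fst z))) * (sqrt (r (snd z)) * sqrt (t (snd z)))"
      unfolding rt[symmetric] using c[OF z(1)] c[OF z(2)] by (intro mult_mono) auto
    then show "c (fst z) * c (snd z) \<le> sqrt (r (fst z) * r (snd z)) * sqrt (t (fst z) * t (snd z))"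
      by (simp add: real_sqrt_mult mult_ac)
  qed
  moreover have "0 \<le> (\<Sum>z\<in>I. c (fst z) * c (snd z))"
    using c by (intro sum_nonneg mult_nonneg_nonneg) (auto simp: I_def)
  ultimately have "(\<Sum>z\<in>I. c (fst z) * c (snd z))\<^sup>2 \<le>
      (\<Sum>z\<in>I. sqrt (r (fst z) * r (snd z)) * sqrt (t (fst z) * t (snd z)))\<^sup>2"
    by (rule power_mono)
  also have "\<dots> \<le> (\<Sum>z\<in>I. (sqrt (r (fst z) * r (snd z)))\<^sup>2) * (\<Sum>z\<in>I. (sqrt (t (fst z) * t (snd z)))\<^sup>2)"
    by (rule Cauchy_Schwarz_ineq_sum)
  also have "\<dots> = (\<Sum>z\<in>I. r (fst z) * r (snd z)) * (\<Sum>z\<in>I. t (fst z) * t (snd z))"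
    using nonneg by simp
  also have "\<dots> \<le> (l ^ 6 / R) * (l ^ k\<^sup>2 * l ^ k\<^sup>2)"
  proof (intro mult_mono)
    have r_le: "r n \<le> l ^ 3 * log_weight n" if "n \<in> {1..X}" for n
    proof -
      have "0 < 1 + ln (real n)" using that by (simp add: add_pos_nonneg)
      moreover have "1 + ln (real n) \<le> l" using that by (simp add: l_def)
      ultimately have "(1 + ln (real n)) ^ 3 > 0" "(1 + ln (real n)) ^ 3 \<le> l ^ 3" by (auto intro: power_mono)
      then have "1 \<le> l ^ 3 / (1 + ln (real n)) ^ 3" by simp
      then have "r n * 1 \<le> r n * (l ^ 3 / (1 + ln (real n)) ^ 3)"
        by (intro mult_left_mono nonneg)
      then show ?thesis by (simp add: r_def log_weight_def)
    qed
    have "(\<Sum>z\<in>I. r (fst z) * r (snd z)) \<le> (\<Sum>z\<in>I. (l ^ 3 * log_weight (fst z)) * (l ^ 3 * log_weight (snd z)))"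
      using r_le nonneg l by (intro sum_mono mult_mono) (auto simp: I_def log_weight_nonneg)
    also have "\<dots> = l ^ 6 * (\<Sum>z\<in>I. log_weight (fst z) * log_weight (snd z))"
      by (simp add: sum_distrib_left mult_ac flip: power_add)
    also have "\<dots> \<le> l ^ 6 * (1 / R)"
      using small l unfolding I by (intro mult_left_mono) auto
    finally show "(\<Sum>z\<in>I. r (fst z) * r (snd z)) \<le> l ^ 6 / R" by simp
  next
    have "(\<Sum>n\<in>{1..X}. t n) \<le> (\<Sum>n\<in>{1..X}. r n) ^ k\<^sup>2"
      unfolding t_def by (rule sum_divisor_tau_square_le) (simp_all add: r_def)
    also have "\<dots> \<le> l ^ k\<^sup>2"
      using harmonic_sum_le[OF X] nonneg unfolding r_def l_def by (intro power_mono sum_nonneg) auto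
    finally have t: "(\<Sum>n\<in>{1..X}. t n) \<le> l ^ k\<^sup>2" .
    have "(\<Sum>z\<in>I. t (fst z) * t (snd z)) \<le> (\<Sum>z\<in>{1..X} \<times> {1..X}. t (fst z) * t (snd z))"
      using nonneg by (intro sum_mono2) (auto simp: I_def)
    also have "\<dots> = (\<Sum>n\<in>{1..X}. t n) * (\<Sum>n\<in>{1..X}. t n)"
      by (simp add: sum_product sum.cartesian_product case_prod_beta)
    also have "\<dots> \<le> l ^ k\<^sup>2 * l ^ k\<^sup>2"
      using t l nonneg by (intro mult_mono sum_nonneg) auto
    finally show "(\<Sum>z\<in>I. t (fst z) * t (snd z)) \<le> l ^ k\<^sup>2 * l ^ k\<^sup>2" .
  qed (use R l nonneg in \<open>auto intro!: sum_nonneg\<close>)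
  \<comment> \<open>Six logarithms convert \<open>1 / (a b)\<close> into the two cubed weights, and
    each sum of \<open>t\<close> gives \<open>k\<^sup>2\<close>; the square root halves the
    total.\<close>
  also have "\<dots> = (l ^ (k\<^sup>2 + 3) / sqrt R)\<^sup>2"
  proof -
    have "l ^ 6 * (l ^ k\<^sup>2 * l ^ k\<^sup>2) = (l ^ (k\<^sup>2 + 3))\<^sup>2"
      by (simp only: power2_eq_square flip: power_add) (simp add: add_ac)
    then show ?thesis using R by (simp add: power_divide)
  qed
  finally have "(\<Sum>z\<in>I. c (fst z) * c (snd z)) \<le> l ^ (k\<^sup>2 + 3) / sqrt R"
    by (rule power2_le_imp_le) (use R l in auto)
  then show ?thesis unfolding I l_def .
qed

section \<open>From truncated sums to the moments\<close>

lemma power_diff_le: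
  fixes x y A :: real
  assumes "0 \<le> x" "x \<le> A" "0 \<le> y" "y \<le> A" "1 \<le> A" "\<bar>x - y\<bar> \<le> e"
  shows "\<bar>x ^ n - y ^ n\<bar> \<le> real n * A ^ n * e"
proof (induction n)
  case (Suc n)
  have e: "e \<ge> 0" using assms by linarith
  have "x ^ Suc n - y ^ Suc n = x * (x ^ n - y ^ n) + (x - y) * y ^ n" by (simp add: algebra_simps)
  then have "\<bar>x ^ Suc n - y ^ Suc n\<bar> \<le> \<bar>x\<bar> * \<bar>x ^ n - y ^ n\<bar> + \<bar>x - y\<bar> * \<bar>y ^ n\<bar>"
    by (metis abs_mult abs_triangle_ineq)
  also have "\<dots> \<le> A * (real n * A ^ n * e) + e * A ^ n"
    using assms Suc e by (intro add_mono mult_mono) (auto intro!: power_mono)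
  \<comment> \<open>\<open>A \<ge> 1\<close> permits one more power of \<open>A\<close>, which
    restores the shape needed for the induction.\<close>
  also have "\<dots> \<le> A * (real n * A ^ n * e) + e * A ^ Suc n"
    using assms e by (intro add_left_mono mult_left_mono power_increasing) auto
  finally show ?case by (simp add: algebra_simps)
qed simp

text \<open>\<open>e\<close> is at most 3. For odd primes all powers of \<open>ln p\<close> can thus
  be compared by their exponents.\<close>

lemma ln_prime_ge_1: "p > 2 \<Longrightarrow> ln (real p) \<ge> 1"
  using exp_le by (subst ln_ge_iff) (auto intro: order_trans)

text \<open>At length \<open>p^2\<close> the tail is at most \<open>4 / p\<close>, and both
  \<open>L(1,\<chi>)\<close> and its truncation are at most \<open>5 ln p\<close>. The constant is
  \<open>2 k * 5^(2 k) * 4\<close>.\<close>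

lemma moment_truncation:
  assumes p: "prime p" "p > 2" and m: "m dvd p - 1" "d = (p - 1) div m" "odd d"
  defines "S \<equiv> \<lambda>f. \<Sum>n\<in>{1..p\<^sup>2}. char_ext p f (int n) / of_nat n"
  shows "\<bar>L_moment (2 * k) p m - 2 / real m * (\<Sum>f\<in>odd_characters p m. norm (S f) ^ (2 * k))\<bar>
    \<le> 8 * real k * 25 ^ k * (ln (real p) ^ (2 * k) / real p)"
proof -
  define B where "B = odd_characters p m"
  note card = odd_characters_card[OF p m]
  have lnp: "ln (real p) \<ge> 1" using p(2) by (rule ln_prime_ge_1)
  have bound: "\<bar>norm (L_one p f) ^ (2 * k) - norm (S f) ^ (2 * k)\<bar> \<le>
      real (2 * k) * (5 * ln (real p)) ^ (2 * k) * (4 / real p)" if f: "f \<in> B" for f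
  proof -
    have fm: "f \<in> mult_characters p"
      using f by (simp add: B_def odd_characters_def characters_trivial_on_index_def)
    have "norm (L_one p f - S f) \<le> 4 * real p / real (p\<^sup>2 + 1)"
      unfolding S_def by (rule L_one_tail[OF p(1) f[unfolded B_def]])
    also have "\<dots> \<le> 4 * real p / real (p\<^sup>2)"
      using p by (intro frac_le) auto
    finally have diff: "norm (L_one p f - S f) \<le> 4 / real p"
      using p by (simp add: power2_eq_square)
    have "norm (S f) \<le> (\<Sum>n\<in>{1..p\<^sup>2}. 1 / real n)"
      unfolding S_def using norm_char_ext_le[OF p(1) fm]
      by (intro sum_norm_le) (auto simp: norm_divide intro!: divide_right_mono)
    also have "\<dots> \<le> 1 + ln (real (p\<^sup>2))" using p by (intro harmonic_sum_le) simp
    also have "\<dots> = 1 + 2 * ln (real p)" using p by (simp add: ln_realpow)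
    \<comment> \<open>The 5 splits as 3 for the harmonic sum up to \<open>p^2\<close> and 2 for the
      tail, each times \<open>ln p \<ge> 1\<close>.\<close>
    finally have S: "norm (S f) \<le> 3 * ln (real p)" using lnp by linarith
    have "norm (L_one p f) \<le> norm (S f) + norm (L_one p f - S f)"
      using norm_triangle_ineq[of "S f" "L_one p f - S f"] by simp
    moreover have "4 / real p \<le> 2" using p by (simp add: field_simps)
    ultimately have L: "norm (L_one p f) \<le> 5 * ln (real p)" using S diff lnp by linarith
    show ?thesis
      using norm_triangle_ineq3[of "L_one p f" "S f"] L S diff lnp
      by (intro power_diff_le) auto
  qed
  have "\<bar>L_moment (2 * k) p m - 2 / real m * (\<Sum>f\<in>B. norm (S f) ^ (2 * k))\<bar> =
      \<bar>2 / real m * (\<Sum>f\<in>B. norm (L_one p f) ^ (2 * k) - norm (S f) ^ (2 * k))\<bar>"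
    by (simp only: L_moment_def B_def sum_subtractf right_diff_distrib)
  also have "\<dots> = 2 / real m * \<bar>\<Sum>f\<in>B. norm (L_one p f) ^ (2 * k) - norm (S f) ^ (2 * k)\<bar>"
    by (simp add: abs_mult)
  also have "\<dots> \<le> 2 / real m * (\<Sum>f\<in>B. real (2 * k) * (5 * ln (real p)) ^ (2 * k) * (4 / real p))"
    using bound by (intro mult_left_mono order_trans[OF sum_abs sum_mono]) auto
  also have "\<dots> = (2 * real (card B) / real m) * (real (2 * k) * (5 * ln (real p)) ^ (2 * k) * (4 / real p))"
    by simp
  also have "2 * real (card B) = real m"
    using card(2) unfolding B_def by (metis of_nat_mult of_nat_numeral)
  also have "real m / real m * (real (2 * k) * (5 * ln (real p)) ^ (2 * k) * (4 / real p)) =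
      8 * real k * 25 ^ k * (ln (real p) ^ (2 * k) / real p)"
    using card(3) by (simp add: power_mult_distrib power_mult)
  finally show ?thesis by (simp add: B_def)
qed

text \<open>The three errors are the truncation, the coincidences and the tail of the diagonal. For
  length \<open>X = p^(2 k)\<close> the quantity \<open>1 + ln X\<close> is at most
  \<open>3 k ln p\<close>.\<close>

lemma L_moment_approx:
  assumes p: "prime p" "p > 2" "p \<notin> exceptional_primes D R" and R: "R \<ge> 2" and k: "k \<ge> 1"
    and m: "m dvd p - 1" "d = (p - 1) div m" "odd d" "real d \<le> D"
  shows "\<bar>L_moment (2 * k) p m - a_const k\<bar> \<le>
    8 * real k * 25 ^ k * (ln (real p) ^ (2 * k) / real p) +
    (3 * real k * ln (real p)) ^ (k\<^sup>2 + 3) / sqrt R +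
    tau_bound k * real p powr (- (1 / 2))"
proof -
  define N where "N = p\<^sup>2"
  define X where "X = N ^ k"
  define c where "c = (\<lambda>n. real (bounded_tau N k n) / real n)"
  have lnp: "ln (real p) \<ge> 1" using p(2) by (rule ln_prime_ge_1)
  have X: "X > 0" using p by (simp add: X_def N_def)
  have d: "d > 0" using m(3) by (auto intro: Nat.gr0I)
  have "d dvd p - 1"
    using dvd_div_mult_self[OF m(1)] unfolding m(2)[symmetric] by (metis dvd_triv_left)
  then have "\<not> 1 / R < (\<Sum>(a, b)\<in>{1..X} \<times> {1..X}. if power_coincidence p d a b then log_weight a * log_weight b else 0)"
    using p d m unfolding exceptional_primes_def by blast
  then have "(\<Sum>(a, b)\<in>{1..X} \<times> {1..X}. if power_coincidence p d a b then c a * c b else 0)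
      \<le> (1 + ln (real X)) ^ (k\<^sup>2 + 3) / sqrt R"
    using R X by (intro off_diagonal_bound) (auto simp: c_def intro!: divide_right_mono bounded_tau_le)
  also have "\<dots> \<le> (3 * real k * ln (real p)) ^ (k\<^sup>2 + 3) / sqrt R"
  proof (intro divide_right_mono power_mono)
    have "ln (real X) = real k * (2 * ln (real p))"
      using p by (simp add: X_def N_def ln_realpow)
    moreover have "1 \<le> real k * ln (real p)"
      using k lnp mult_mono[of 1 "real k" 1 "ln (real p)"] by simp
    ultimately show "1 + ln (real X) \<le> 3 * real k * ln (real p)" by simp
  qed (use R X in auto)
  finally have off: "(\<Sum>(a, b)\<in>{1..X} \<times> {1..X}. if power_coincidence p d a b then c a * c b else 0)
      \<le> (3 * real k * ln (real p)) ^ (k\<^sup>2 + 3) / sqrt R" .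
  have "\<bar>(\<Sum>n\<in>{1..X}. if p dvd n then 0 else c n ^ 2) - a_const k\<bar> \<le> tau_bound k * real p powr (- (1 / 2))"
  proof -
    have "p \<le> N" by (simp add: N_def power2_eq_square)
    moreover have "c n ^ 2 = real (bounded_tau N k n) ^ 2 / real n ^ 2" for n
      by (simp add: c_def power_divide)
    ultimately show ?thesis using diagonal_approx[of p N k] p k by (simp only: X_def)
  qed
  moreover have "\<bar>2 / real m * (\<Sum>f\<in>odd_characters p m.
        norm (\<Sum>n\<in>{1..N}. char_ext p f (int n) / of_nat n) ^ (2 * k)) -
      (\<Sum>n\<in>{1..X}. if p dvd n then 0 else c n ^ 2)\<bar>
    \<le> (\<Sum>(a, b)\<in>{1..X} \<times> {1..X}. if power_coincidence p d a b then c a * c b else 0)"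
    using moment_expansion[OF p(1,2) m(1-3), of N k] by (simp only: X_def c_def)
  ultimately show ?thesis
    using moment_truncation[OF p(1,2) m(1-3), of k] off
    unfolding N_def[symmetric] by linarith
qed

theorem theorem2p13:
  shows "\<exists>(C :: real) (K :: nat \<Rightarrow> real). \<forall>(D :: real) (R :: real). D \<ge> 2 \<longrightarrow> R \<ge> 2 \<longrightarrow>
    (\<exists>E :: nat set. finite E \<and> E \<subseteq> {p. prime p} \<and>
       real (card E) \<le> C * (D\<^sup>2 * R * (ln R)\<^sup>2 / ln D) \<and>
       (\<forall>p :: nat. prime p \<longrightarrow> p \<notin> E \<longrightarrow>
         (\<forall>k :: nat. k \<ge> 1 \<longrightarrow>
           (\<forall>m d :: nat. m dvd p - 1 \<longrightarrow> d = (p - 1) div m \<longrightarrow> odd d \<longrightarrow> real d \<le> D \<longrightarrow>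
             \<bar>L_moment (2 * k) p m - a_const k\<bar>
               \<le> K k * (ln (real p) ^ (10 * k\<^sup>2 + 10) / R powr (1/2)
                        + D * ln (real p) ^ (20 * k) / real p
                        + real p powr (- 1/2))))))"
proof -
  obtain C where C: "\<And>D R. D \<ge> 2 \<Longrightarrow> R \<ge> 2 \<Longrightarrow> finite (exceptional_primes D R) \<and>
    real (card (exceptional_primes D R)) \<le> C * (D\<^sup>2 * R * (ln R)\<^sup>2 / ln D)"
    using exceptional_primes_bound by blast
  \<comment> \<open>The first three terms belong to truncation, coincidences and diagonal;
    \<open>2 * a_const k\<close> is reserved for \<open>p = 2\<close>.\<close>
  define K where "K k = 8 * real k * 25 ^ k + (3 * real k) ^ (k\<^sup>2 + 3) + tau_bound k + 2 * a_const k" for k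
  have main: "\<bar>L_moment (2 * k) p m - a_const k\<bar>
      \<le> K k * (ln (real p) ^ (10 * k\<^sup>2 + 10) / R powr (1/2) + D * ln (real p) ^ (20 * k) / real p
        + real p powr (- 1/2))"
    if D: "D \<ge> 2" and R: "R \<ge> 2" and p: "prime p" "p \<notin> exceptional_primes D R" and k: "k \<ge> 1"
      and m: "m dvd p - 1" "d = (p - 1) div m" "odd d" "real d \<le> D"
    for D R :: real and p k m d :: nat
  proof -
    define T1 where "T1 = ln (real p) ^ (10 * k\<^sup>2 + 10) / R powr (1/2)"
    define T2 where "T2 = D * ln (real p) ^ (20 * k) / real p"
    define T3 where "T3 = real p powr (- (1/2))"
    have pos: "p > 0" using p(1) by (rule prime_gt_0_nat)
    then have T: "T1 \<ge> 0" "T2 \<ge> 0" "T3 \<ge> 0"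
      using D R by (auto simp: T1_def T2_def T3_def)
    define K1 K2 K3 where "K1 = (3 * real k) ^ (k\<^sup>2 + 3)" and "K2 = 8 * real k * 25 ^ k" and "K3 = tau_bound k"
    have K: "K1 \<ge> 0" "K2 \<ge> 0" "K3 \<ge> 0" "a_const k \<ge> 0" "K k = K1 + K2 + K3 + 2 * a_const k"
      by (simp_all add: K1_def K2_def K3_def K_def tau_bound_nonneg a_const_nonneg)
    have "\<bar>L_moment (2 * k) p m - a_const k\<bar> \<le> K k * (T1 + T2 + T3)"
    \<comment> \<open>For \<open>p = 2\<close> the moment is 0 and the error term must absorb all of
      \<open>a(k)\<close>, which it does through \<open>2 * 2^(-1/2) \<ge> 1\<close>.\<close>
    proof (cases "p = 2")
      case True
      then have "L_moment (2 * k) p m = 0"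
        using odd_characters_2 m(1) by (simp add: L_moment_def)
      moreover have "1 \<le> 2 * T3"
      proof -
        have "2 powr (1/2) \<le> (2 :: real) powr 1" by (rule powr_mono) auto
        then show ?thesis using True by (simp add: T3_def powr_minus field_simps)
      qed
      then have "a_const k * 1 \<le> a_const k * (2 * T3)"
        using K by (intro mult_left_mono) auto
      moreover have "a_const k * (2 * T3) \<le> K k * (T1 + T2 + T3)"
      proof -
        have "(2 * a_const k) * T3 \<le> K k * (T1 + T2 + T3)"
          using K T by (intro mult_mono) auto
        then show ?thesis by simp
      qed
      ultimately show ?thesis using K(4) by simp
    next
      case False
      then have p2: "p > 2" using prime_ge_2_nat[OF p(1)] by simp
      have lnp: "ln (real p) \<ge> 1" using p2 by (rule ln_prime_ge_1)
      \<comment> \<open>Both \<open>D\<close> and \<open>ln p\<close> are at least 1, so the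
        truncation error fits into the second term of the claim.\<close>
      have "ln (real p) ^ (2 * k) / real p \<le> T2"
      proof -
        have "1 * ln (real p) ^ (2 * k) \<le> D * ln (real p) ^ (20 * k)"
          using D lnp by (intro mult_mono power_increasing) auto
        then show ?thesis unfolding T2_def by (simp add: divide_right_mono)
      qed
      then have 2: "K2 * (ln (real p) ^ (2 * k) / real p) \<le> K2 * T2"
        using K by (intro mult_left_mono)
      have "(3 * real k * ln (real p)) ^ (k\<^sup>2 + 3) / sqrt R = K1 * (ln (real p) ^ (k\<^sup>2 + 3) / R powr (1/2))"
        using R by (simp add: K1_def power_mult_distrib powr_half_sqrt)
      also have "\<dots> \<le> K1 * T1"
        unfolding T1_def using lnp K R
        by (intro mult_left_mono divide_right_mono power_increasing) auto
      finally have 1: "(3 * real k * ln (real p)) ^ (k\<^sup>2 + 3) / sqrt R \<le> K1 * T1" .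
      have "\<bar>L_moment (2 * k) p m - a_const k\<bar> \<le> K2 * T2 + K1 * T1 + K3 * T3"
        using L_moment_approx[OF p(1) p2 p(2) R k m] 1 2 unfolding K2_def K3_def T3_def by linarith
      also have "\<dots> \<le> K k * T2 + K k * T1 + K k * T3"
        using K T by (intro add_mono mult_right_mono) auto
      finally show ?thesis by (simp add: algebra_simps)
    qed
    then show ?thesis by (simp add: T1_def T2_def T3_def)
  qed
  show ?thesis
  proof (intro exI[of _ C] exI[of _ K] allI impI)
    fix D R :: real assume DR: "2 \<le> D" "2 \<le> R"
    show "\<exists>E :: nat set. finite E \<and> E \<subseteq> {p. prime p} \<and>
       real (card E) \<le> C * (D\<^sup>2 * R * (ln R)\<^sup>2 / ln D) \<and>
       (\<forall>p :: nat. prime p \<longrightarrow> p \<notin> E \<longrightarrow>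
         (\<forall>k :: nat. k \<ge> 1 \<longrightarrow>
           (\<forall>m d :: nat. m dvd p - 1 \<longrightarrow> d = (p - 1) div m \<longrightarrow> odd d \<longrightarrow> real d \<le> D \<longrightarrow>
             \<bar>L_moment (2 * k) p m - a_const k\<bar>
               \<le> K k * (ln (real p) ^ (10 * k\<^sup>2 + 10) / R powr (1/2)
                        + D * ln (real p) ^ (20 * k) / real p
                        + real p powr (- 1/2)))))"
    proof (intro exI[of _ "exceptional_primes D R"] conjI allI impI)
      show "exceptional_primes D R \<subseteq> {p. prime p}" by (auto simp: exceptional_primes_def)
    qed (use C[OF DR] main[OF DR] in blast)+
  qed
qed

end
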